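(* Let $B$ be the unit ball of $\mathbb{R}^3$ and let $h\in C^1(\overline{B})$ be a non-negative radial function. Then for every $\varepsilon>0$ there exist $\eta\in(0,1)$ and a radial function $\tilde h\in C^{0,\eta}(B)$ with $\|\tilde h-h\|_{L^3(B)}\le\varepsilon$ such that the equation $$\Delta\tilde u+\tilde h\tilde u=\tilde u^5\ \text{ in }B,\qquad \tilde u=0\ \text{ on }\partial B,$$ admits a positive radial solution $\tilde u$.
   Context: The Laplacian is taken with the sign convention $\Delta u=-\sum_{i=1}^3\partial^2u/\partial x_i^2$. The space $C^{0,\eta}(B)$ is the space of bounded uniformly $\eta$-Hölder continuous functions on $B$. A solution is a function $u\in C^2(B)\cap C^0(\overline{B})$ satisfying the equation in $B$ and the boundary condition; positive means $u>0$ in $B$. A function on $B$ is radial if it depends only on $|x|$. *)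

theory Defs
  imports "HOL-Analysis.Analysis"
begin

definition partial_deriv :: "'n::finite \<Rightarrow> (real ^ 'n \<Rightarrow> real) \<Rightarrow> real ^ 'n \<Rightarrow> real" where
  "partial_deriv i u x = frechet_derivative u (at x) (axis i 1)"

(* The classes C1_on, C2_on, C1_closure_on below are meant for open S. A function on S or on
   its closure is represented by a total function; only its values there matter. *)

definition C1_on :: "(real ^ 'n::finite) set \<Rightarrow> (real ^ 'n \<Rightarrow> real) \<Rightarrow> bool" where
  "C1_on S u \<longleftrightarrow>
     (\<forall>x\<in>S. u differentiable (at x)) \<and> (\<forall>i. continuous_on S (partial_deriv i u))"

definition C2_on :: "(real ^ 'n::finite) set \<Rightarrow> (real ^ 'n \<Rightarrow> real) \<Rightarrow> bool" where
  "C2_on S u \<longleftrightarrow> C1_on S u \<and> (\<forall>i. C1_on S (partial_deriv i u))"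

(* C^1 up to the boundary: u and its first partial derivatives on S extend continuously to the
   closure of S. *)
definition C1_closure_on :: "(real ^ 'n::finite) set \<Rightarrow> (real ^ 'n \<Rightarrow> real) \<Rightarrow> bool" where
  "C1_closure_on S u \<longleftrightarrow>
     C1_on S u \<and> continuous_on (closure S) u \<and>
     (\<forall>i. \<exists>g. continuous_on (closure S) g \<and> (\<forall>x\<in>S. g x = partial_deriv i u x))"

definition bounded_hoelder_on :: "real \<Rightarrow> (real ^ 'n::finite) set \<Rightarrow> (real ^ 'n \<Rightarrow> real) \<Rightarrow> bool" where
  "bounded_hoelder_on \<eta> S f \<longleftrightarrow>
     bounded (f ` S) \<and> (\<exists>C. \<forall>x\<in>S. \<forall>y\<in>S. \<bar>f x - f y\<bar> \<le> C * dist x y powr \<eta>)"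

definition radial_on :: "(real ^ 'n::finite) set \<Rightarrow> (real ^ 'n \<Rightarrow> real) \<Rightarrow> bool" where
  "radial_on S f \<longleftrightarrow> (\<forall>x\<in>S. \<forall>y\<in>S. norm x = norm y \<longrightarrow> f x = f y)"

(* The Bochner integral is 0 for a non-integrable integrand, so this is the L^p norm only for f
   in L^p(S), for instance f bounded and continuous on a bounded open S. *)
definition Lp_norm_on :: "real \<Rightarrow> (real ^ 'n::finite) set \<Rightarrow> (real ^ 'n \<Rightarrow> real) \<Rightarrow> real" where
  "Lp_norm_on p S f = (LINT x:S|lebesgue. \<bar>f x\<bar> powr p) powr (1 / p)"

(* Geometers' sign convention: minus the sum of the second derivatives. *)
definition laplacian :: "(real ^ 'n::finite \<Rightarrow> real) \<Rightarrow> real ^ 'n \<Rightarrow> real" where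
  "laplacian u x = - (\<Sum>i\<in>UNIV. partial_deriv i (partial_deriv i u) x)"

definition critical_dirichlet_solution ::
    "(real ^ 3) set \<Rightarrow> (real ^ 3 \<Rightarrow> real) \<Rightarrow> (real ^ 3 \<Rightarrow> real) \<Rightarrow> bool" where
  "critical_dirichlet_solution S h u \<longleftrightarrow>
     C2_on S u \<and> continuous_on (closure S) u \<and>
     (\<forall>x\<in>S. laplacian u x + h x * u x = u x ^ 5) \<and>
     (\<forall>x\<in>frontier S. u x = 0)"

end

theory Submission
  imports Defs
begin

text \<open>
  Choose a positive radial \<open>u\<close> vanishing on the boundary and read off the potential
  \<open>u\<^sup>4 - \<Delta>u / u\<close>. Let \<open>h x = K |x|\<close> and let \<open>W\<close> solve \<open>W'' = K W\<close>, \<open>W 1 = 0\<close>,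
  \<open>W' 1 = -1\<close>, so that \<open>W |x| / |x|\<close> is a multiple of the Green function of \<open>\<Delta> + h\<close> with pole 0;
  \<open>h \<ge> 0\<close> makes \<open>W\<close> positive. Take \<open>u\<close> to be a concentrated bubble \<open>(|x|\<^sup>2 + l\<^sup>2)\<^bsup>-1/2\<^esup>\<close>,
  suitably scaled, times \<open>W (\<rho> |x|)\<close>, where \<open>\<rho>\<close> is smooth in \<open>|x|\<^sup>2\<close> and close to the identity. For fixed
  \<open>\<rho>\<close> and \<open>l \<rightarrow> 0\<close> the potential tends to
  \<open>K (\<rho> r) (\<rho>' r)\<^sup>2 + (W'/W) (\<rho> r) \<rho>'' r\<close> in \<open>L\<^sup>3\<close>. The slope of \<open>\<rho>\<close> has to
  increase from 0 to 1, and \<open>L\<^sup>3\<close> is scale invariant for \<open>\<rho>''\<close>; but spreading the increase over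
  all scales between \<open>\<mu>\<close> and 1 gives \<open>\<rho>'' \<approx> 1 / (r ln (1/\<mu>))\<close>, whose
  \<open>L\<^sup>3\<close> norm tends to 0 with \<open>\<mu>\<close>.
\<close>

subsection \<open>Radial functions of the squared radius\<close>

lemma partial_deriv_eq:
  assumes "(u has_derivative U) (at x)"
  shows "partial_deriv i u x = U (axis i 1)"
  using frechet_derivative_at[OF assms] by (simp add: partial_deriv_def)

lemma C1_onI:
  assumes "\<And>x. x \<in> S \<Longrightarrow> (u has_derivative U x) (at x)"
    and "\<And>i. continuous_on S (\<lambda>x. U x (axis i 1))"
  shows "C1_on S u"
  unfolding C1_on_def
proof (intro conjI ballI allI)
  fix i show "continuous_on S (partial_deriv i u)"
    using assms(2)[of i] by (rule continuous_on_eq) (simp add: partial_deriv_eq[OF assms(1)])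
qed (use assms(1) in \<open>auto simp: differentiable_def\<close>)

lemma radial_has_derivative:
  fixes f :: "real \<Rightarrow> real" and x :: "'a::real_inner"
  assumes "(f has_real_derivative D) (at (x \<bullet> x))"
  shows "((\<lambda>x. f (x \<bullet> x)) has_derivative (\<lambda>v. 2 * D * (x \<bullet> v))) (at x)"
proof -
  have "((\<lambda>x. x \<bullet> x) has_derivative (\<lambda>v. 2 * (x \<bullet> v))) (at x)"
    by (auto intro!: derivative_eq_intros simp: inner_commute)
  from has_derivative_compose[OF this assms[unfolded has_field_derivative_def]]
  show ?thesis by (simp add: mult_ac)
qed

text \<open>A partial derivative is a function of \<open>x \<bullet> x\<close> times a coordinate,
  so the product rule applies a second time without division by the radius, and the origin needs no
  separate treatment.\<close>

lemma radial_C2_on: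
  fixes f f1 f2 :: "real \<Rightarrow> real" and S :: "(real ^ 'n::finite) set"
  assumes "open S"
    and f: "\<And>x. x \<in> S \<Longrightarrow> (f has_real_derivative f1 (x \<bullet> x)) (at (x \<bullet> x))"
    and f1: "\<And>x. x \<in> S \<Longrightarrow> (f1 has_real_derivative f2 (x \<bullet> x)) (at (x \<bullet> x))"
    and f2: "continuous_on S (\<lambda>x. f2 (x \<bullet> x))"
  shows "C2_on S (\<lambda>x. f (x \<bullet> x))"
    and "\<And>x. x \<in> S \<Longrightarrow> laplacian (\<lambda>x. f (x \<bullet> x)) x
           = - (4 * (x \<bullet> x) * f2 (x \<bullet> x) + 2 * real CARD('n) * f1 (x \<bullet> x))"
proof -
  let ?u = "\<lambda>x. f (x \<bullet> x)"
  have p1: "partial_deriv i ?u x = 2 * f1 (x \<bullet> x) * x $ i" if "x \<in> S" for i x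
    using partial_deriv_eq[OF radial_has_derivative[OF f[OF that]], of i]
    by (simp add: inner_axis)
  have d1: "((\<lambda>x. 2 * f1 (x \<bullet> x) * x $ i) has_derivative
      (\<lambda>v. 2 * f1 (x \<bullet> x) * v $ i + 2 * (2 * f2 (x \<bullet> x) * (x \<bullet> v)) * x $ i)) (at x)"
    if "x \<in> S" for i x
  proof -
    have "((\<lambda>x. x $ i) has_derivative (\<lambda>v. v $ i)) (at x)"
      by (rule bounded_linear_imp_has_derivative[OF bounded_linear_vec_nth])
    from has_derivative_mult[OF has_derivative_mult_right[OF radial_has_derivative[OF f1[OF that]], of 2] this]
    show ?thesis .
  qed
  have d2: "(partial_deriv i ?u has_derivative
      (\<lambda>v. 2 * f1 (x \<bullet> x) * v $ i + 2 * (2 * f2 (x \<bullet> x) * (x \<bullet> v)) * x $ i)) (at x)"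
    if "x \<in> S" for i x
    by (rule has_derivative_transform_within_open[OF d1[OF that] \<open>open S\<close> that])
      (simp add: p1)
  have c1: "continuous_on S (\<lambda>x. f1 (x \<bullet> x))"
    by (rule has_derivative_continuous_on[OF has_derivative_at_withinI[OF radial_has_derivative[OF f1]]])
  have "C1_on S ?u"
    by (rule C1_onI[OF radial_has_derivative[OF f]])
      (auto simp: inner_axis intro!: continuous_intros c1)
  moreover have "C1_on S (partial_deriv i ?u)" for i
    by (rule C1_onI[OF d2]) (auto simp: inner_axis intro!: continuous_intros c1 f2)
  ultimately show "C2_on S ?u"
    by (simp add: C2_on_def)
  fix x assume x: "x \<in> S"
  have "(\<Sum>i\<in>UNIV. partial_deriv i (partial_deriv i ?u) x)
    = (\<Sum>i\<in>UNIV. 2 * f1 (x \<bullet> x) + 4 * f2 (x \<bullet> x) * (x $ i * x $ i))"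
    by (rule sum.cong) (auto simp: partial_deriv_eq[OF d2[OF x]] inner_axis)
  also have "\<dots> = 4 * (x \<bullet> x) * f2 (x \<bullet> x) + 2 * real CARD('n) * f1 (x \<bullet> x)"
    by (simp add: sum.distrib sum_distrib_left[symmetric] inner_vec_def)
  finally show "laplacian ?u x
           = - (4 * (x \<bullet> x) * f2 (x \<bullet> x) + 2 * real CARD('n) * f1 (x \<bullet> x))"
    by (simp add: laplacian_def)
qed

text \<open>The interval is the range of \<open>x \<bullet> x\<close> on the open unit ball: all radial functions below are
  written as functions of the squared radius, which keeps them smooth at the origin.\<close>

definition bdd_lipschitz :: "(real \<Rightarrow> real) \<Rightarrow> bool" where
  "bdd_lipschitz f \<longleftrightarrow>
     (\<exists>C. \<forall>x\<in>{0..<1}. \<bar>f x\<bar> \<le> C \<and> (\<forall>y\<in>{0..<1}. \<bar>f x - f y\<bar> \<le> C * \<bar>x - y\<bar>))"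

lemma bdd_lipschitzI:
  assumes "\<And>x. x \<in> {0..<1} \<Longrightarrow> \<bar>f x\<bar> \<le> B"
    and "\<And>x y. x \<in> {0..<1} \<Longrightarrow> y \<in> {0..<1} \<Longrightarrow> \<bar>f x - f y\<bar> \<le> C * \<bar>x - y\<bar>"
  shows "bdd_lipschitz f"
  unfolding bdd_lipschitz_def
proof (intro exI[of _ "max B C"] ballI conjI)
  fix x y :: real assume "x \<in> {0..<1}" "y \<in> {0..<1}"
  then show "\<bar>f x\<bar> \<le> max B C" "\<bar>f x - f y\<bar> \<le> max B C * \<bar>x - y\<bar>"
    using assms(1)[of x] assms(2)[of x y] mult_right_mono[of C "max B C" "\<bar>x - y\<bar>"] by auto
qed

lemma bdd_lipschitzE:
  assumes "bdd_lipschitz f"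
  obtains C where "0 < C" "\<And>x. x \<in> {0..<1} \<Longrightarrow> \<bar>f x\<bar> \<le> C"
    "\<And>x y. x \<in> {0..<1} \<Longrightarrow> y \<in> {0..<1} \<Longrightarrow> \<bar>f x - f y\<bar> \<le> C * \<bar>x - y\<bar>"
proof -
  from assms obtain C where C: "\<And>x. x \<in> {0..<1} \<Longrightarrow> \<bar>f x\<bar> \<le> C"
    "\<And>x y. x \<in> {0..<1} \<Longrightarrow> y \<in> {0..<1} \<Longrightarrow> \<bar>f x - f y\<bar> \<le> C * \<bar>x - y\<bar>"
    unfolding bdd_lipschitz_def by blast
  show ?thesis
  proof (rule that[of "\<bar>C\<bar> + 1"])
    fix x y :: real assume xy: "x \<in> {0..<1}" "y \<in> {0..<1}"
    show "\<bar>f x\<bar> \<le> \<bar>C\<bar> + 1" using C(1)[OF xy(1)] by linarith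
    have "C * \<bar>x - y\<bar> \<le> (\<bar>C\<bar> + 1) * \<bar>x - y\<bar>" by (rule mult_right_mono) auto
    then show "\<bar>f x - f y\<bar> \<le> (\<bar>C\<bar> + 1) * \<bar>x - y\<bar>" using C(2)[OF xy] by linarith
  qed auto
qed

section \<open>Closure properties of bounded Lipschitz functions\<close>

named_theorems bdd_lipschitz_intros

lemma bdd_lipschitz_const [bdd_lipschitz_intros]: "bdd_lipschitz (\<lambda>x. c)"
  by (rule bdd_lipschitzI[where B="\<bar>c\<bar>" and C=0]) auto

lemma bdd_lipschitz_ident [bdd_lipschitz_intros]: "bdd_lipschitz (\<lambda>x. x)"
  by (rule bdd_lipschitzI[where B=1 and C=1]) auto

lemma bdd_lipschitz_add [bdd_lipschitz_intros]:
  assumes "bdd_lipschitz f" "bdd_lipschitz g"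
  shows "bdd_lipschitz (\<lambda>x. f x + g x)"
proof -
  obtain C where "0 < C" and C: "\<And>x. x \<in> {0..<1} \<Longrightarrow> \<bar>f x\<bar> \<le> C"
    "\<And>x y. x \<in> {0..<1} \<Longrightarrow> y \<in> {0..<1} \<Longrightarrow> \<bar>f x - f y\<bar> \<le> C * \<bar>x - y\<bar>"
    by (rule bdd_lipschitzE[OF assms(1)]) blast
  obtain D where "0 < D" and D: "\<And>x. x \<in> {0..<1} \<Longrightarrow> \<bar>g x\<bar> \<le> D"
    "\<And>x y. x \<in> {0..<1} \<Longrightarrow> y \<in> {0..<1} \<Longrightarrow> \<bar>g x - g y\<bar> \<le> D * \<bar>x - y\<bar>"
    by (rule bdd_lipschitzE[OF assms(2)]) blast
  show ?thesis
  proof (rule bdd_lipschitzI)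
    fix x y :: real assume "x \<in> {0..<1}" "y \<in> {0..<1}"
    then show "\<bar>f x + g x\<bar> \<le> C + D" "\<bar>f x + g x - (f y + g y)\<bar> \<le> (C + D) * \<bar>x - y\<bar>"
      using C(1)[of x] D(1)[of x] C(2)[of x y] D(2)[of x y] unfolding distrib_right by linarith+
  qed
qed

lemma bdd_lipschitz_mult [bdd_lipschitz_intros]:
  assumes "bdd_lipschitz f" "bdd_lipschitz g"
  shows "bdd_lipschitz (\<lambda>x. f x * g x)"
proof -
  obtain C where C: "C > 0" "\<And>x. x \<in> {0..<1} \<Longrightarrow> \<bar>f x\<bar> \<le> C"
    "\<And>x y. x \<in> {0..<1} \<Longrightarrow> y \<in> {0..<1} \<Longrightarrow> \<bar>f x - f y\<bar> \<le> C * \<bar>x - y\<bar>"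
    by (rule bdd_lipschitzE[OF assms(1)]) blast
  obtain D where D: "D > 0" "\<And>x. x \<in> {0..<1} \<Longrightarrow> \<bar>g x\<bar> \<le> D"
    "\<And>x y. x \<in> {0..<1} \<Longrightarrow> y \<in> {0..<1} \<Longrightarrow> \<bar>g x - g y\<bar> \<le> D * \<bar>x - y\<bar>"
    by (rule bdd_lipschitzE[OF assms(2)]) blast
  show ?thesis
  proof (rule bdd_lipschitzI)
    fix x y :: real assume xy: "x \<in> {0..<1}" "y \<in> {0..<1}"
    show "\<bar>f x * g x\<bar> \<le> C * D"
      unfolding abs_mult using C D xy by (intro mult_mono) auto
    have "f x * g x - f y * g y = f x * (g x - g y) + (f x - f y) * g y"
      by (simp add: algebra_simps)
    moreover have "\<bar>f x * (g x - g y)\<bar> \<le> C * (D * \<bar>x - y\<bar>)"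
      unfolding abs_mult using C D xy by (intro mult_mono) auto
    moreover have "\<bar>(f x - f y) * g y\<bar> \<le> (C * \<bar>x - y\<bar>) * D"
      unfolding abs_mult using C D xy by (intro mult_mono) auto
    ultimately have "\<bar>f x * g x - f y * g y\<bar> \<le> C * (D * \<bar>x - y\<bar>) + (C * \<bar>x - y\<bar>) * D"
      by linarith
    then show "\<bar>f x * g x - f y * g y\<bar> \<le> (2 * C * D) * \<bar>x - y\<bar>"
      by (simp add: mult_ac)
  qed
qed

lemma bdd_lipschitz_cong:
  assumes "bdd_lipschitz f" "\<And>x. x \<in> {0..<1} \<Longrightarrow> f x = g x"
  shows "bdd_lipschitz g"
  using assms unfolding bdd_lipschitz_def by auto

lemma bdd_lipschitz_minus [bdd_lipschitz_intros]:
  "bdd_lipschitz f \<Longrightarrow> bdd_lipschitz (\<lambda>x. - f x)"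
  using bdd_lipschitz_mult[OF bdd_lipschitz_const[of "-1"]] by simp

lemma bdd_lipschitz_diff [bdd_lipschitz_intros]:
  "bdd_lipschitz f \<Longrightarrow> bdd_lipschitz g \<Longrightarrow> bdd_lipschitz (\<lambda>x. f x - g x)"
  using bdd_lipschitz_add[of f "\<lambda>x. - g x"] bdd_lipschitz_minus[of g] by simp

lemma bdd_lipschitz_power [bdd_lipschitz_intros]:
  "bdd_lipschitz f \<Longrightarrow> bdd_lipschitz (\<lambda>x. f x ^ n)"
  by (induction n) (simp_all add: bdd_lipschitz_const bdd_lipschitz_mult)

lemma bdd_lipschitz_compose:
  assumes "bdd_lipschitz f" "\<And>x. x \<in> {0..<1} \<Longrightarrow> f x \<in> S"
    and "\<And>x y. x \<in> S \<Longrightarrow> y \<in> S \<Longrightarrow> \<bar>g x - g y\<bar> \<le> L * \<bar>x - y\<bar>"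
  shows "bdd_lipschitz (\<lambda>x. g (f x))"
proof -
  obtain C where C: "C > 0" "\<And>x. x \<in> {0..<1} \<Longrightarrow> \<bar>f x\<bar> \<le> C"
    "\<And>x y. x \<in> {0..<1} \<Longrightarrow> y \<in> {0..<1} \<Longrightarrow> \<bar>f x - f y\<bar> \<le> C * \<bar>x - y\<bar>"
    by (rule bdd_lipschitzE[OF assms(1)]) blast
  have *: "\<bar>g (f x) - g (f y)\<bar> \<le> \<bar>L\<bar> * C * \<bar>x - y\<bar>" if xy: "x \<in> {0..<1}" "y \<in> {0..<1}" for x y
  proof -
    have "\<bar>g (f x) - g (f y)\<bar> \<le> L * \<bar>f x - f y\<bar>" using assms(2,3) xy by blast
    also have "\<dots> \<le> \<bar>L\<bar> * (C * \<bar>x - y\<bar>)" using C xy by (intro mult_mono) auto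
    finally show ?thesis by (simp add: mult_ac)
  qed
  show ?thesis
  proof (rule bdd_lipschitzI[where B="\<bar>g (f 0)\<bar> + \<bar>L\<bar> * C"])
    fix x :: real assume x: "x \<in> {0..<1}"
    have "\<bar>L\<bar> * C * \<bar>x - 0\<bar> \<le> \<bar>L\<bar> * C * 1" using x C by (intro mult_left_mono) auto
    with *[of x 0] x show "\<bar>g (f x)\<bar> \<le> \<bar>g (f 0)\<bar> + \<bar>L\<bar> * C" by auto
  qed (rule *)
qed

lemma bdd_lipschitz_continuous:
  assumes "bdd_lipschitz f"
  shows "continuous_on {0..<1} f"
proof -
  obtain C where "0 < C" and C: "\<And>x. x \<in> {0..<1} \<Longrightarrow> \<bar>f x\<bar> \<le> C"
    "\<And>x y. x \<in> {0..<1} \<Longrightarrow> y \<in> {0..<1} \<Longrightarrow> \<bar>f x - f y\<bar> \<le> C * \<bar>x - y\<bar>"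
    by (rule bdd_lipschitzE[OF assms]) blast
  then have "C-lipschitz_on {0..<1} f"
    by (intro lipschitz_onI) (auto simp: dist_real_def)
  then show ?thesis by (rule lipschitz_on_continuous_on)
qed

lemma bdd_lipschitz_inverse:
  assumes "bdd_lipschitz f" "0 < m" "\<And>x. x \<in> {0..<1} \<Longrightarrow> m \<le> f x"
  shows "bdd_lipschitz (\<lambda>x. inverse (f x))"
proof (rule bdd_lipschitz_compose[OF assms(1), where S="{m..}" and L="inverse (m * m)"])
  fix x y assume xy: "x \<in> {m..}" "y \<in> {m..}"
  have "\<bar>inverse x - inverse y\<bar> = inverse (x * y) * \<bar>x - y\<bar>"
    using xy \<open>0 < m\<close> by (simp add: inverse_diff_inverse abs_mult mult_ac abs_minus_commute)
  also have "\<dots> \<le> inverse (m * m) * \<bar>x - y\<bar>"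
    using xy \<open>0 < m\<close> by (intro mult_right_mono le_imp_inverse_le mult_mono) auto
  finally show "\<bar>inverse x - inverse y\<bar> \<le> inverse (m * m) * \<bar>x - y\<bar>" .
qed (simp add: assms(3))

lemma bdd_lipschitz_divide:
  assumes "bdd_lipschitz g" "bdd_lipschitz f" "0 < m" "\<And>x. x \<in> {0..<1} \<Longrightarrow> m \<le> f x"
  shows "bdd_lipschitz (\<lambda>x. g x / f x)"
  unfolding divide_inverse by (rule bdd_lipschitz_mult[OF assms(1) bdd_lipschitz_inverse[OF assms(2-4)]])

lemma bdd_lipschitz_C1:
  assumes d: "\<And>t. t \<in> {0..1} \<Longrightarrow> (f has_real_derivative f' t) (at t)"
    and cont: "continuous_on {0..1} f'"
  shows "bdd_lipschitz f"
proof -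
  obtain x where x: "\<And>t. t \<in> {0..1} \<Longrightarrow> \<bar>f' t\<bar> \<le> \<bar>f' x\<bar>"
    using continuous_attains_sup[of "{0..1}" "\<lambda>t. \<bar>f' t\<bar>"] continuous_on_rabs[OF cont]
    by (auto simp del: atLeastAtMost_iff)
  have "\<bar>f t - f s\<bar> \<le> \<bar>f' x\<bar> * \<bar>t - s\<bar>" if "t \<in> {0..1}" "s \<in> {0..1}" for t s
    using field_differentiable_bound[of "{0..1}" f f' "\<bar>f' x\<bar>" t s] d x that
    by (auto simp: has_field_derivative_at_within)
  then show ?thesis
    by (intro bdd_lipschitz_compose[OF bdd_lipschitz_ident, of "{0..1}"]) auto
qed

text \<open>Because \<open>F 1 = 0\<close>, the quotient is minus the mean of \<open>F'\<close> over
  the interval from \<open>t\<close> to 1, and taking means preserves a Lipschitz constant. Instead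
  of an integral, the mean value theorem is used along the segments from 1 to \<open>t\<close> and
  to \<open>s\<close>, traversed with a common parameter \<open>\<tau>\<close>.\<close>

lemma bdd_lipschitz_quotient:
  assumes cont: "continuous_on {0..1} F" and F1: "F 1 = 0"
    and F': "\<And>t. t \<in> {0..<1} \<Longrightarrow> (F has_real_derivative F' t) (at t)"
    and lip: "bdd_lipschitz F'"
  shows "bdd_lipschitz (\<lambda>t. F t / (1 - t))"
proof -
  obtain C where C: "C > 0" and "\<And>x. x \<in> {0..<1} \<Longrightarrow> \<bar>F' x\<bar> \<le> C"
    and C': "\<And>x y. x \<in> {0..<1} \<Longrightarrow> y \<in> {0..<1} \<Longrightarrow> \<bar>F' x - F' y\<bar> \<le> C * \<bar>x - y\<bar>"
    by (rule bdd_lipschitzE[OF lip]) blast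
  have *: "\<bar>F t / (1 - t) - F s / (1 - s)\<bar> \<le> C * \<bar>t - s\<bar>" if ts: "t \<in> {0..<1}" "s \<in> {0..<1}" for t s
  proof -
    \<comment> \<open>The derivative of \<open>\<Phi>\<close> only involves a difference of two values of \<open>F'\<close>.\<close>
    define \<Phi> where "\<Phi> \<tau> = F (1 - \<tau> * (1 - t)) / (1 - t) - F (1 - \<tau> * (1 - s)) / (1 - s)" for \<tau>
    have r: "1 - \<tau> * (1 - x) \<in> {0..1}" if "\<tau> \<in> {0..1}" "x \<in> {0..<1}" for \<tau> x :: real
      using that mult_le_one[of \<tau> "1 - x"] by auto
    have r': "1 - \<tau> * (1 - x) \<in> {0..<1}" if "\<tau> \<in> {0<..<1}" "x \<in> {0..<1}" for \<tau> x :: real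
      using that r[of \<tau> x] by auto
    have c: "continuous_on {0..1} (\<lambda>\<tau>. F (1 - \<tau> * (1 - x)))" if "x \<in> {0..<1}" for x
      by (rule continuous_on_compose2[OF cont]) (intro continuous_intros, use r that in blast)
    have d: "((\<lambda>\<tau>. F (1 - \<tau> * (1 - x)) / (1 - x)) has_real_derivative - F' (1 - \<tau> * (1 - x))) (at \<tau>)"
      if "\<tau> \<in> {0<..<1}" "x \<in> {0..<1}" for x \<tau>
    proof -
      have "((\<lambda>\<tau>. F (1 - \<tau> * (1 - x))) has_real_derivative F' (1 - \<tau> * (1 - x)) * (- (1 - x))) (at \<tau>)"
        by (rule DERIV_chain2[where g = "\<lambda>\<tau>. 1 - \<tau> * (1 - x)", OF F'[OF r'[OF that]]]) (auto intro!: derivative_eq_intros)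
      from DERIV_cdivide[OF this, of "1 - x"] show ?thesis
        using that by (simp del: minus_diff_eq)
    qed
    have "continuous_on {0..1} \<Phi>"
      unfolding \<Phi>_def using ts by (intro continuous_intros c) auto
    moreover have D: "(\<Phi> has_real_derivative - F' (1 - \<tau> * (1 - t)) - - F' (1 - \<tau> * (1 - s))) (at \<tau>)"
      if "\<tau> \<in> {0<..<1}" for \<tau>
      unfolding \<Phi>_def using that ts by (intro DERIV_diff d) auto
    ultimately have "\<exists>l \<xi>. 0 < \<xi> \<and> \<xi> < 1 \<and> DERIV \<Phi> \<xi> :> l \<and> \<Phi> 1 - \<Phi> 0 = (1 - 0) * l"
      by (intro MVT) (auto simp: real_differentiable_def)
    then obtain l \<xi> where \<xi>: "\<xi> \<in> {0<..<1}" and l: "DERIV \<Phi> \<xi> :> l" "\<Phi> 1 - \<Phi> 0 = l"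
      by auto
    have eq: "\<Phi> 1 - \<Phi> 0 = - F' (1 - \<xi> * (1 - t)) - - F' (1 - \<xi> * (1 - s))"
      using DERIV_unique[OF l(1) D[OF \<xi>]] l(2) by simp
    have "\<bar>F t / (1 - t) - F s / (1 - s)\<bar>
        = \<bar>- F' (1 - \<xi> * (1 - t)) - - F' (1 - \<xi> * (1 - s))\<bar>"
      using eq F1 by (simp add: \<Phi>_def)
    also have "\<dots> \<le> C * \<bar>(1 - \<xi> * (1 - t)) - (1 - \<xi> * (1 - s))\<bar>"
      using C'[OF r'[OF \<xi> ts(1)] r'[OF \<xi> ts(2)]] by linarith
    also have "(1 - \<xi> * (1 - t)) - (1 - \<xi> * (1 - s)) = \<xi> * (t - s)"
      by (simp add: algebra_simps)
    also have "C * \<bar>\<xi> * (t - s)\<bar> = C * (\<xi> * \<bar>t - s\<bar>)"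
      using \<xi> by (simp add: abs_mult)
    also have "\<dots> \<le> C * (1 * \<bar>t - s\<bar>)"
      using \<xi> C by (intro mult_left_mono mult_right_mono) auto
    finally show ?thesis by simp
  qed
  show ?thesis
  proof (rule bdd_lipschitzI[where B="\<bar>F 0\<bar> + C"])
    fix x :: real assume x: "x \<in> {0..<1}"
    have "C * \<bar>x - 0\<bar> \<le> C * 1" using x C by (intro mult_left_mono) auto
    with *[of x 0] x show "\<bar>F x / (1 - x)\<bar> \<le> \<bar>F 0\<bar> + C" by auto
  qed (rule *)
qed

subsection \<open>A linear second-order equation\<close>

text \<open>Against an exponential weight of rate \<open>m\<close>, one integration gains the factor
  \<open>1 / m\<close>. For large \<open>m\<close> this beats the bound of the coefficient, so the
  Volterra series below converges on the whole interval at once.\<close>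

lemma integral_exp_bound:
  fixes f :: "real \<Rightarrow> real"
  assumes cont: "continuous_on {0..b} f" and m: "0 < m"
    and bound: "\<And>s. s \<in> {0..b} \<Longrightarrow> 0 \<le> f s \<and> f s \<le> c * exp (m * s)" and s: "s \<in> {0..b}"
  shows "0 \<le> integral {0..s} f \<and> integral {0..s} f \<le> c / m * exp (m * s)"
proof
  have int: "f integrable_on {0..s}"
    by (rule integrable_continuous_real, rule continuous_on_subset[OF cont]) (use s in auto)
  show "0 \<le> integral {0..s} f"
    by (rule integral_nonneg[OF int]) (use bound s in auto)
  have c: "0 \<le> c"
  proof -
    have "0 \<le> c * exp (m * s)" using bound[OF s] by linarith
    then show ?thesis by (simp add: zero_le_mult_iff)
  qed
  have "((\<lambda>s. c * exp (m * s)) has_integral (c / m * exp (m * s) - c / m * exp (m * 0))) {0..s}"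
    by (rule fundamental_theorem_of_calculus)
      (use s m in \<open>auto intro!: derivative_eq_intros
        simp flip: has_real_derivative_iff_has_vector_derivative\<close>)
  then have "integral {0..s} f \<le> c / m * exp (m * s) - c / m * exp (m * 0)"
    by (rule has_integral_le[OF integrable_integral[OF int]]) (use bound s in auto)
  also have "\<dots> \<le> c / m * exp (m * s)" using c m by simp
  finally show "integral {0..s} f \<le> c / m * exp (m * s)" .
qed

text \<open>The terms of the Volterra series of \<open>y'' = k y\<close>, \<open>y 0 = 0\<close>, \<open>y' 0 = 1\<close>, paired with their
  derivatives.\<close>

primrec volterra :: "(real \<Rightarrow> real) \<Rightarrow> nat \<Rightarrow> (real \<Rightarrow> real) \<times> (real \<Rightarrow> real)" where
  "volterra k 0 = (\<lambda>s. s, \<lambda>s. 1)"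
| "volterra k (Suc n) =
     (let z = \<lambda>s. integral {0..s} (\<lambda>t. k t * fst (volterra k n) t)
      in (\<lambda>s. integral {0..s} z, z))"

text \<open>The solution is the sum of the Volterra series. As \<open>k\<close> is nonnegative, so
  are all terms, and the sum is at least its first term \<open>s\<close>; this is how a nonnegative
  \<open>h\<close> yields a positive profile.\<close>

lemma linear_second_order_ode:
  fixes k :: "real \<Rightarrow> real"
  assumes b: "0 \<le> b" and cont: "continuous_on {0..b} k"
    and nonneg: "\<And>s. s \<in> {0..b} \<Longrightarrow> 0 \<le> k s"
  obtains y z where "y 0 = 0"
    "\<And>s. s \<in> {0..b} \<Longrightarrow> (y has_real_derivative z s) (at s within {0..b})"
    "\<And>s. s \<in> {0..b} \<Longrightarrow> (z has_real_derivative k s * y s) (at s within {0..b})"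
    "\<And>s. s \<in> {0..b} \<Longrightarrow> s \<le> y s"
proof -
  obtain k0 where k0: "\<And>s. s \<in> {0..b} \<Longrightarrow> k s \<le> k0" and "0 \<le> k0"
  proof -
    obtain x where "x \<in> {0..b}" "\<And>s. s \<in> {0..b} \<Longrightarrow> k s \<le> k x"
      using continuous_attains_sup[OF compact_Icc _ cont] b by auto
    with nonneg that show ?thesis by blast
  qed
  \<comment> \<open>\<open>2 * k0 \<le> m * m\<close> gives \<open>k0 / m \<le> m / 2\<close>, the
    gain of one iteration; the \<open>+ 1\<close> secures \<open>1 \<le> m\<close> for the first
    term.\<close>
  define m where "m = sqrt (2 * k0 + 1)"
  have m2: "m * m = 2 * k0 + 1" and m: "1 \<le> m"
    using \<open>0 \<le> k0\<close> by (auto simp: m_def)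
  define y where "y n = fst (volterra k n)" for n
  define z where "z n = snd (volterra k n)" for n
  have rec: "y 0 = (\<lambda>s. s)" "z 0 = (\<lambda>s. 1)"
    "z (Suc n) = (\<lambda>s. integral {0..s} (\<lambda>t. k t * y n t))" "y (Suc n) = (\<lambda>s. integral {0..s} (z (Suc n)))" for n
    by (simp_all add: y_def z_def Let_def)
  have y0: "y n 0 = 0" for n by (cases n) (simp_all add: rec)
  have cz: "continuous_on {0..b} (z n)" and cy: "continuous_on {0..b} (y n)" for n
  proof (induction n)
    case (Suc n)
    { case 1
      show ?case unfolding rec
        by (intro indefinite_integral_continuous_1 integrable_continuous_real continuous_intros cont Suc) }
    note cz = this
    case 2
    show ?case unfolding rec(4)
      by (intro indefinite_integral_continuous_1 integrable_continuous_real cz)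
  qed (auto simp: rec intro!: continuous_intros)
  have dy: "(y n has_real_derivative z n s) (at s within {0..b})" if "s \<in> {0..b}" for n s
  proof (cases n)
    case 0 show ?thesis unfolding 0 rec by (auto intro!: derivative_eq_intros)
  next
    case (Suc n) show ?thesis unfolding Suc rec(4) by (rule integral_has_real_derivative[OF cz that])
  qed
  have dz: "(z (Suc n) has_real_derivative k s * y n s) (at s within {0..b})" if "s \<in> {0..b}" for n s
    unfolding rec
    by (rule integral_has_real_derivative[OF _ that]) (intro continuous_intros cont cy)
  \<comment> \<open>The rate \<open>m\<close> of the exponential weight is chosen such that each step gains a factor \<open>1/2\<close>.\<close>
  have bounds: "\<forall>s\<in>{0..b}. (0 \<le> z n s \<and> z n s \<le> (m * (1/2)^n) * exp (m * s))
    \<and> (0 \<le> y n s \<and> y n s \<le> (1/2)^n * exp (m * s))" for n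
  proof (induction n)
    case 0
    have "1 \<le> exp (m * s)" if "s \<in> {0..b}" for s using that m by simp
    moreover have "s \<le> exp (m * s)" if "s \<in> {0..b}" for s
    proof -
      have "s \<le> m * s" using that m mult_right_mono[of 1 m s] by auto
      also have "\<dots> \<le> exp (m * s)" using exp_ge_add_one_self[of "m * s"] by linarith
      finally show ?thesis .
    qed
    moreover have "1 * 1 \<le> m * exp (m * s)" if "s \<in> {0..b}" for s
      using m calculation(1)[OF that] by (intro mult_mono) auto
    ultimately show ?case by (auto simp: rec)
  next
    case (Suc n)
    have y: "0 \<le> y n s" "y n s \<le> (1/2)^n * exp (m * s)" if "s \<in> {0..b}" for s
      using Suc that by blast+
    have z: "0 \<le> z (Suc n) s \<and> z (Suc n) s \<le> (k0 * (1/2)^n) / m * exp (m * s)" if "s \<in> {0..b}" for s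
      unfolding rec
    proof (rule integral_exp_bound[OF _ _ _ that])
      fix t assume t: "t \<in> {0..b}"
      then have "k t * y n t \<le> k0 * ((1/2)^n * exp (m * t))"
        using y[OF t] k0 nonneg \<open>0 \<le> k0\<close> by (intro mult_mono) auto
      then show "0 \<le> k t * y n t \<and> k t * y n t \<le> (k0 * (1/2)^n) * exp (m * t)"
        using y[OF t] nonneg[OF t] by (simp add: mult_ac)
    qed (use m in \<open>auto intro!: continuous_intros cont cy\<close>)
    have "k0 * (1/2)^n / m \<le> m * (1/2) ^ Suc n"
      using m m2 by (simp add: field_simps)
    then have z': "0 \<le> z (Suc n) s \<and> z (Suc n) s \<le> (m * (1/2)^Suc n) * exp (m * s)" if "s \<in> {0..b}" for s
      using z[OF that] mult_right_mono[of "k0 * (1/2)^n / m" "m * (1/2) ^ Suc n" "exp (m * s)"] by (meson exp_ge_zero order_trans)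
    have "0 \<le> y (Suc n) s \<and> y (Suc n) s \<le> (m * (1/2)^Suc n) / m * exp (m * s)" if "s \<in> {0..b}" for s
      unfolding rec(4) by (rule integral_exp_bound[OF cz _ z' that]) (use m in auto)
    then have "0 \<le> y (Suc n) s \<and> y (Suc n) s \<le> (1/2)^Suc n * exp (m * s)" if "s \<in> {0..b}" for s
      using that m by auto
    with z' show ?case by blast
  qed
  have bound: "0 \<le> z n s \<and> z n s \<le> (m * (1/2)^n) * exp (m * s)"
    and ybound: "0 \<le> y n s \<and> y n s \<le> (1/2)^n * exp (m * s)" if "s \<in> {0..b}" for n s
    using bounds that by blast+
  have zero_in: "0 \<in> {0..b}" "convex {0..b}" using b by auto
  have geom: "summable (\<lambda>n. C * (1/2)^n)" for C :: real
    by (intro summable_mult summable_geometric) auto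
  have exp_le: "exp (m * s) \<le> exp (m * b)" if "s \<in> {0..b}" for s
    using that m by simp
  have yM: "\<bar>y n s\<bar> \<le> exp (m * b) * (1/2)^n" and zM: "\<bar>z n s\<bar> \<le> m * exp (m * b) * (1/2)^n"
    if s: "s \<in> {0..b}" for n s
  proof -
    have "(1/2)^n * exp (m * s) \<le> (1/2)^n * exp (m * b)"
      "(m * (1/2)^n) * exp (m * s) \<le> (m * (1/2)^n) * exp (m * b)"
      using m exp_le[OF s] by (auto intro!: mult_left_mono)
    with bound[OF s, of n] ybound[OF s, of n] show "\<bar>y n s\<bar> \<le> exp (m * b) * (1/2)^n"
      "\<bar>z n s\<bar> \<le> m * exp (m * b) * (1/2)^n"
      by (smt (verit) mult.commute mult.left_commute)+
  qed
  \<comment> \<open>\<open>d n\<close> is the derivative of \<open>z n\<close>: it vanishes for the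
    constant \<open>z 0\<close> and afterwards involves \<open>y\<close> at the previous index, so
    the series of the \<open>d n\<close> sums to \<open>k s * Y s\<close>. The factor 2 in
    \<open>dM\<close> pays for the shift of the index.\<close>
  define d where "d n s = (case n of 0 \<Rightarrow> 0 | Suc n \<Rightarrow> k s * y n s)" for n s
  have dz': "(z n has_real_derivative d n s) (at s within {0..b})" if "s \<in> {0..b}" for n s
    using dz[OF that] by (cases n) (auto simp: d_def rec(2) intro!: derivative_eq_intros)
  have dM: "\<bar>d n s\<bar> \<le> 2 * k0 * exp (m * b) * (1/2)^n" if s: "s \<in> {0..b}" for n s
  proof (cases n)
    case (Suc j)
    have "\<bar>k s * y j s\<bar> \<le> k0 * (exp (m * b) * (1/2)^j)"
      unfolding abs_mult using k0[OF s] nonneg[OF s] yM[OF s] by (intro mult_mono) auto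
    then show ?thesis by (simp add: Suc d_def mult_ac)
  qed (use \<open>0 \<le> k0\<close> in \<open>simp add: d_def\<close>)
  have "uniform_limit {0..b} (\<lambda>n s. \<Sum>i<n. z i s) (\<lambda>s. \<Sum>i. z i s) sequentially"
    by (rule Weierstrass_m_test[OF _ geom]) (use zM in auto)
  moreover have "summable (\<lambda>n. y n 0)" by (simp add: y0)
  ultimately obtain Y where Y: "\<And>s. s \<in> {0..b} \<Longrightarrow> (\<lambda>n. y n s) sums Y s"
    "\<And>s. s \<in> {0..b} \<Longrightarrow> (Y has_real_derivative (\<Sum>i. z i s)) (at s within {0..b})"
    using has_field_derivative_series[of "{0..b}" y z "\<lambda>s. \<Sum>i. z i s" 0] dy zero_in
    by blast
  have "uniform_limit {0..b} (\<lambda>n s. \<Sum>i<n. d i s) (\<lambda>s. \<Sum>i. d i s) sequentially"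
    by (rule Weierstrass_m_test[OF _ geom]) (use dM in auto)
  moreover have "summable (\<lambda>n. z n 0)"
    by (rule summable_comparison_test'[OF geom]) (use zM b in auto)
  ultimately obtain Z where Z: "\<And>s. s \<in> {0..b} \<Longrightarrow> (\<lambda>n. z n s) sums Z s"
    "\<And>s. s \<in> {0..b} \<Longrightarrow> (Z has_real_derivative (\<Sum>i. d i s)) (at s within {0..b})"
    using has_field_derivative_series[of "{0..b}" z d "\<lambda>s. \<Sum>i. d i s" 0] dz' zero_in
    by blast
  show ?thesis
  proof (rule that)
    show "Y 0 = 0"
      using Y(1)[of 0] b y0 sums_unique2[OF _ sums_zero] by simp
    fix s assume s: "s \<in> {0..b}"
    show "(Y has_real_derivative Z s) (at s within {0..b})"
      using Y(2)[OF s] sums_unique[OF Z(1)[OF s]] by simp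
    have "(\<lambda>n. d (Suc n) s) sums (k s * Y s)"
      unfolding d_def by (simp add: sums_mult[OF Y(1)[OF s]])
    from sums_Suc[OF this] have "(\<lambda>n. d n s) sums (k s * Y s)" by (simp add: d_def)
    then show "(Z has_real_derivative k s * Y s) (at s within {0..b})"
      using Z(2)[OF s] sums_unique by metis
    show "s \<le> Y s"
      using sum_le_suminf[OF sums_summable[OF Y(1)[OF s]], of "{0}"] ybound[OF s] sums_unique[OF Y(1)[OF s]]
      by (simp add: rec(1))
  qed
qed

subsection \<open>A dyadic bound for an inverse cube\<close>

text \<open>For \<open>r\<close> between \<open>(1/2)^(n+1)\<close> and \<open>(1/2)^n\<close> the
  inverse cube is at most \<open>8^(n+1)\<close>, the summand of index \<open>n\<close>; below the
  cutoff the last summand suffices. Volumes of balls thus replace polar coordinates.\<close>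

lemma dyadic_bound:
  fixes r :: real
  assumes "0 \<le> r" "r < 1"
  shows "(1 / max r ((1/2)^N)) ^ 3 \<le> (\<Sum>n\<le>N. 8 ^ (n + 1) * (if r < (1/2)^n then 1 else 0))"
proof (induction N)
  case 0
  then show ?case using assms by simp
next
  case (Suc N)
  show ?case
  proof (cases "r < (1/2)^N")
    case True
    let ?S = "\<lambda>N. \<Sum>n\<le>N. 8 ^ (n + 1) * (if r < (1/2)^n then 1 else 0 :: real)"
    have "(1 / max r ((1/2)^Suc N)) ^ 3 \<le> (1 / (1/2)^Suc N) ^ 3"
      using assms by (intro power_mono divide_left_mono mult_pos_pos) (auto simp: less_max_iff_disj)
    also have "\<dots> = 8 ^ (N + 1)"
      by (simp add: power_divide flip: power_mult power_mult_distrib)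
        (simp add: power_mult mult.commute[of N])
    also have "\<dots> = 8 ^ (N + 1) * (if r < (1/2)^N then 1 else 0)"
      using True by simp
    also have "\<dots> \<le> ?S (Suc N)"
      by (rule member_le_sum) auto
    finally show ?thesis .
  next
    case False
    have "(1/2 :: real)^Suc N \<le> (1/2)^N" by simp
    with False have "max r ((1/2)^Suc N) = r" "max r ((1/2)^N) = r"
      by (intro max_absorb1, linarith)+
    moreover have "\<not> r < (1/2)^Suc N" using calculation by linarith
    ultimately show ?thesis using Suc by (simp del: power_Suc)
  qed
qed

definition dyadic :: "nat \<Rightarrow> real ^ 3 \<Rightarrow> real" where
  "dyadic N x = (\<Sum>n\<le>N. 8 ^ (n + 1) * indicator (ball 0 ((1/2)^n)) x)"

lemma inverse_cube_le_dyadic: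
  assumes "x \<in> ball 0 1"
  shows "(1 / sqrt (x \<bullet> x + ((1/2)^N)\<^sup>2)) ^ 3 \<le> dyadic N x"
proof -
  have "max (norm x) ((1/2)^N) \<le> sqrt (x \<bullet> x + ((1/2)^N)\<^sup>2)"
    by (auto intro!: real_le_rsqrt simp: power2_norm_eq_inner)
  then have "(1 / sqrt (x \<bullet> x + ((1/2)^N)\<^sup>2)) ^ 3 \<le> (1 / max (norm x) ((1/2)^N)) ^ 3"
    by (intro power_mono divide_left_mono mult_pos_pos) (auto simp: less_max_iff_disj add_nonneg_pos)
  also have "\<dots> \<le> (\<Sum>n\<le>N. 8 ^ (n + 1) * (if norm x < (1/2)^n then 1 else 0))"
    by (rule dyadic_bound) (use assms in auto)
  also have "\<dots> = dyadic N x"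
    unfolding dyadic_def by (rule sum.cong) (auto simp: indicator_def)
  finally show ?thesis .
qed

lemma dyadic_nonneg: "0 \<le> dyadic N x"
  by (simp add: dyadic_def sum_nonneg)

text \<open>The weight \<open>8 ^ (n + 1)\<close> cancels the volume of the ball of radius
  \<open>(1/2)^n\<close> up to a constant, so every scale contributes the same amount. The integral
  grows only logarithmically in the cutoff radius.\<close>

lemma dyadic_integral:
  "integrable lebesgue (dyadic N)" (is ?int)
  "(LINT x|lebesgue. dyadic N x) = 32 / 3 * pi * (real N + 1)" (is ?eq)
proof -
  have "emeasure lebesgue (ball (0 :: real ^ 3) r) < \<infinity>" for r
    using emeasure_bounded_finite[OF bounded_ball] by simp
  then have int: "integrable lebesgue (\<lambda>x :: real ^ 3. 8 ^ (n + 1) * indicator (ball 0 ((1/2)^n)) x :: real)" for n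
    by (intro integrable_mult_right integrable_real_indicator) auto
  show ?int unfolding dyadic_def[abs_def] by (intro Bochner_Integration.integrable_sum int)
  have "(LINT x|lebesgue. 8 ^ (n + 1) * indicator (ball 0 ((1/2)^n)) (x :: real ^ 3) :: real)
    = 32 / 3 * pi" for n
    by (simp add: sphere_volume power_divide flip: power_mult)
      (simp add: power_mult mult.commute[of n])
  then have "(\<Sum>n\<le>N. LINT x|lebesgue. 8 ^ (n + 1) * indicator (ball 0 ((1/2)^n)) (x :: real ^ 3) :: real)
      = (\<Sum>n\<le>N. 32 / 3 * pi)"
    by (simp only:)
  then show ?eq unfolding dyadic_def
    by (subst Bochner_Integration.integral_sum[OF int]) (simp only: sum_constant card_atMost, simp)
qed

subsection \<open>A flattened radius\<close>

lemma abs_ln_le: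
  fixes s :: real
  assumes "0 < s"
  shows "\<bar>ln s\<bar> \<le> s + 1 / s"
proof -
  have "ln s \<le> s - 1" "- ln s \<le> 1 / s - 1" "0 < 1 / s"
    using assms ln_le_minus_one[of s] ln_le_minus_one[of "1 / s"] by (auto simp: ln_div)
  then show ?thesis using assms by linarith
qed

lemma ln_le_square: "1 \<le> s \<Longrightarrow> ln s \<le> s\<^sup>2 / (2 :: real)"
  using ln_le_minus_one[of "s\<^sup>2"] by (simp add: ln_realpow)

locale log_flattening =
  fixes \<mu> :: real
  assumes mu: "0 < \<mu>" "\<mu> \<le> 1/8"
begin

text \<open>In terms of the radius \<open>r = sqrt t\<close>, the function \<open>\<rho> r = P t\<close> has \<open>\<rho>' = 2 r P'\<close> and
  \<open>\<rho>'' = 4 t P'' + 2 P'\<close>. Without the term \<open>\<kappa> t\<close> it is the function with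
  \<open>\<rho>' = r (ln (\<sigma>/\<mu>) + 1) / \<sigma>\<close>, up to normalisation: the slope rises from 0 to 1 evenly on the
  logarithmic scale between \<open>\<mu>\<close> and 1. The constant \<open>\<kappa>\<close> makes \<open>\<rho>''\<close> vanish at
  \<open>r = 1\<close>, and \<open>A\<close>, of order \<open>1 / ln (1/\<mu>)\<close>, normalises \<open>\<rho> 1 = 1\<close>.\<close>

definition "\<sigma> t = sqrt (t + \<mu>\<^sup>2)"
definition "G s = (\<mu>\<^sup>2 * ln (s / \<mu>) / s\<^sup>2 + 1) / s"
definition "\<kappa> = G (\<sigma> 1) / 2"
definition "A = 1 / (\<sigma> 1 * ln (\<sigma> 1 / \<mu>) - \<kappa>)"
definition "P t = A * (\<sigma> t * ln (\<sigma> t / \<mu>) - \<kappa> * t)"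
definition "P1 t = A * ((ln (\<sigma> t / \<mu>) + 1) / (2 * \<sigma> t) - \<kappa>)"
definition "P2 t = - A * ln (\<sigma> t / \<mu>) / (4 * \<sigma> t ^ 3)"

lemma sigma_pos: "- (\<mu>\<^sup>2) < t \<Longrightarrow> 0 < \<sigma> t"
  by (simp add: \<sigma>_def)

lemma sigma_sq: "- (\<mu>\<^sup>2) < t \<Longrightarrow> (\<sigma> t)\<^sup>2 = t + \<mu>\<^sup>2"
  by (simp add: \<sigma>_def)

lemma sigma_ge: "0 \<le> t \<Longrightarrow> \<mu> \<le> \<sigma> t"
  using mu by (auto simp: \<sigma>_def intro!: real_le_rsqrt)

lemma sigma_mono: "s \<le> t \<Longrightarrow> \<sigma> s \<le> \<sigma> t"
  by (simp add: \<sigma>_def)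

lemma sigma_1: "1 \<le> \<sigma> 1" "\<sigma> 1 \<le> 1 + \<mu>\<^sup>2"
proof -
  show "1 \<le> \<sigma> 1" by (simp add: \<sigma>_def)
  show "\<sigma> 1 \<le> 1 + \<mu>\<^sup>2" unfolding \<sigma>_def using mu
    by (intro real_le_lsqrt) (auto simp: power2_eq_square algebra_simps)
qed

lemma mu_sq: "\<mu>\<^sup>2 \<le> 1/64" "0 < \<mu>\<^sup>2"
  using mu power_mono[of \<mu> "1/8" 2] by (auto simp: power2_eq_square)

lemma nonneg_gt: "0 \<le> t \<Longrightarrow> - (\<mu>\<^sup>2) < t"
  using mu_sq by linarith

lemma sigma_has_derivative:
  assumes "- (\<mu>\<^sup>2) < t"
  shows "(\<sigma> has_real_derivative 1 / (2 * \<sigma> t)) (at t)"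
  unfolding \<sigma>_def[abs_def] using assms
  by (auto intro!: derivative_eq_intros simp: field_simps)

lemma P_has_derivative:
  assumes t: "- (\<mu>\<^sup>2) < t"
  shows "(P has_real_derivative P1 t) (at t)"
proof -
  have "0 < \<sigma> t / \<mu>" using sigma_pos[OF t] mu by simp
  then show ?thesis
    unfolding P_def[abs_def] P1_def using sigma_pos[OF t] mu
    by (auto intro!: derivative_eq_intros sigma_has_derivative[OF t] simp: field_simps)
qed

lemma P1_has_derivative:
  assumes t: "- (\<mu>\<^sup>2) < t"
  shows "(P1 has_real_derivative P2 t) (at t)"
proof -
  have "0 < \<sigma> t / \<mu>" using sigma_pos[OF t] mu by simp
  then show ?thesis
    unfolding P1_def[abs_def] P2_def using sigma_pos[OF t] mu
    by (auto intro!: derivative_eq_intros sigma_has_derivative[OF t]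
        simp: field_simps power2_eq_square power3_eq_cube)
qed

text \<open>\<open>A * G (\<sigma> t)\<close> is the second radial derivative of the part without
  \<open>\<kappa> * t\<close>, and that term contributes a constant; \<open>\<kappa>\<close> is half
  of \<open>G (\<sigma> 1)\<close> so that the two cancel at \<open>t = 1\<close>.\<close>

lemma flat_identity:
  assumes t: "- (\<mu>\<^sup>2) < t"
  shows "4 * t * P2 t + 2 * P1 t = A * (G (\<sigma> t) - G (\<sigma> 1))"
proof -
  have "t = (\<sigma> t)\<^sup>2 - \<mu>\<^sup>2" using sigma_sq[OF t] by simp
  have s: "\<sigma> t > 0" using sigma_pos[OF t] .
  show ?thesis
    unfolding P2_def P1_def \<kappa>_def G_def[of "\<sigma> t"]
    by (subst \<open>t = _\<close>) (use s in \<open>simp add: field_simps power2_eq_square power3_eq_cube\<close>)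
qed

text \<open>With \<open>x = s / \<mu>\<close> the second bound is
  \<open>ln x / x^2 \<le> 1/2\<close>. Hence \<open>G s\<close> lies between \<open>1 / s\<close>
  and \<open>3/2 / s\<close>.\<close>

lemma ln_sigma:
  assumes "\<mu> \<le> s"
  shows "0 \<le> ln (s / \<mu>)" "\<mu>\<^sup>2 * ln (s / \<mu>) / s\<^sup>2 \<le> 1/2"
proof -
  show "0 \<le> ln (s / \<mu>)" using assms mu by simp
  have "ln (s / \<mu>) \<le> (s / \<mu>)\<^sup>2 / 2" using assms mu by (intro ln_le_square) simp
  then show "\<mu>\<^sup>2 * ln (s / \<mu>) / s\<^sup>2 \<le> 1/2"
    using assms mu by (simp add: field_simps)
qed

definition "L = ln (1 / \<mu>)"

lemma L_ge: "2 \<le> L"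
proof -
  have "exp (2 * 1) \<le> (272/100 :: real)\<^sup>2"
    unfolding exp_double using e_less_272 by (intro power_mono) auto
  then have "exp 2 \<le> (8 :: real)" by (simp add: power2_eq_square)
  then have "2 \<le> ln (8 :: real)" by (simp add: ln_ge_iff)
  also have "\<dots> \<le> L" unfolding L_def using mu by (subst ln_le_cancel_iff) (auto simp: field_simps)
  finally show ?thesis .
qed

lemma ln_div_mu: "0 < s \<Longrightarrow> ln (s / \<mu>) = ln s + L"
  using mu by (simp add: L_def ln_div)

lemma kappa: "0 < \<kappa>" "\<kappa> \<le> 3/4"
proof -
  have s: "\<mu> \<le> \<sigma> 1" "0 < \<sigma> 1" using sigma_ge[of 1] sigma_1 by auto
  have g: "G (\<sigma> 1) * \<sigma> 1 \<le> 3/2" "0 < G (\<sigma> 1)"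
    using ln_sigma[OF s(1)] s unfolding G_def by (auto intro!: divide_pos_pos add_nonneg_pos)
  then show "0 < \<kappa>" by (auto simp: \<kappa>_def)
  have "G (\<sigma> 1) * 1 \<le> G (\<sigma> 1) * \<sigma> 1" using g sigma_1 by (intro mult_left_mono) auto
  then show "\<kappa> \<le> 3/4" using g unfolding \<kappa>_def by linarith
qed

text \<open>The denominator \<open>D\<close> of \<open>A\<close> lies between \<open>L - 3/4\<close>
  and \<open>L + 2\<close>, so \<open>A\<close> is \<open>1 / L\<close> up to a relative error of
  order \<open>A\<close>. The last bound lets errors of size \<open>\<mu>\<close> be absorbed into
  \<open>A\<close>.\<close>

lemma A_bounds: "0 < A" "A \<le> 1" "A * (L - 1) \<le> 1" "\<bar>A * L - 1\<bar> \<le> 2 * A" "\<mu> \<le> 2 * A"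
proof -
  define D where "D = \<sigma> 1 * ln (\<sigma> 1 / \<mu>) - \<kappa>"
  have l: "0 \<le> ln (\<sigma> 1)" "ln (\<sigma> 1) \<le> \<mu>\<^sup>2"
    using sigma_1 ln_le_minus_one[of "\<sigma> 1"] by auto
  have D: "D = \<sigma> 1 * (ln (\<sigma> 1) + L) - \<kappa>" using ln_div_mu[of "\<sigma> 1"] sigma_1 by (simp add: D_def)
  have "1 * (0 + L) \<le> \<sigma> 1 * (ln (\<sigma> 1) + L)"
    using l sigma_1 L_ge by (intro mult_mono) auto
  then have D_ge: "L - 3/4 \<le> D" using kappa by (simp add: D)
  have muL: "\<mu> * L \<le> 1"
    using ln_le_minus_one[of "1 / \<mu>"] mu by (simp add: L_def field_simps)
  have "\<sigma> 1 * (ln (\<sigma> 1) + L) \<le> (1 + \<mu>\<^sup>2) * (\<mu>\<^sup>2 + L)"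
    using l sigma_1 L_ge by (intro mult_mono) auto
  also have "\<dots> = L + \<mu>\<^sup>2 + \<mu>\<^sup>2 * \<mu>\<^sup>2 + \<mu> * (\<mu> * L)" by (simp add: algebra_simps power2_eq_square)
  also have "\<dots> \<le> L + 1/64 + 1 * (1/64) + 1/8 * 1"
    using mu_sq mu muL L_ge by (intro add_mono mult_mono) auto
  finally have D_le: "D \<le> L + 2" using kappa by (simp add: D)
  have A: "A = 1 / D" by (simp add: A_def D_def)
  have "0 < D" using D_ge L_ge by linarith
  show "0 < A" "A \<le> 1" "A * (L - 1) \<le> 1" using D_ge L_ge by (auto simp: A field_simps)
  have "\<bar>A * L - 1\<bar> = \<bar>L - D\<bar> / D" using \<open>0 < D\<close> by (simp add: A field_simps abs_if)
  also have "\<dots> \<le> 2 / D" using \<open>0 < D\<close> D_ge D_le by (intro divide_right_mono) auto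
  finally show "\<bar>A * L - 1\<bar> \<le> 2 * A" by (simp add: A)
  have "\<mu> * D \<le> \<mu> * (L + 2)" using D_le mu by (intro mult_left_mono) auto
  also have "\<dots> \<le> 2" using muL mu by (simp add: algebra_simps)
  finally show "\<mu> \<le> 2 * A" using \<open>0 < D\<close> by (simp add: A field_simps)
qed

lemma P_0: "P 0 = 0" and P_1: "P 1 = 1"
proof -
  show "P 0 = 0" using mu by (simp add: P_def \<sigma>_def)
  show "P 1 = 1" using A_bounds(1) by (simp add: P_def A_def split: if_splits)
qed

text \<open>\<open>P1\<close> is nonincreasing because \<open>P2 \<le> 0\<close>, so its value at 1
  decides. There the \<open>+ 1\<close> in \<open>P1\<close> cancels against a part of
  \<open>\<kappa>\<close>, and what remains is at least
  \<open>1 / (2 * (1 + \<mu>^2)^2)\<close>.\<close>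

lemma P1_ge:
  assumes "0 \<le> t" "t \<le> 1"
  shows "1/4 \<le> P1 t"
proof -
  have "P1 1 \<le> P1 t"
  proof (rule DERIV_nonpos_imp_nonincreasing[OF assms(2)])
    fix x assume x: "t \<le> x" "x \<le> 1"
    have "0 \<le> ln (\<sigma> x / \<mu>)" "0 < \<sigma> x"
      using x assms sigma_ge[of x] ln_sigma[of "\<sigma> x"] mu by auto
    then have "P2 x \<le> 0" using A_bounds(1) by (simp add: P2_def)
    moreover have "(P1 has_real_derivative P2 x) (at x)"
      using x assms by (intro P1_has_derivative nonneg_gt) auto
    ultimately show "\<exists>y. DERIV P1 x :> y \<and> y \<le> 0" by blast
  qed
  moreover have "1/4 \<le> P1 1"
  proof -
    define l where "l = ln (\<sigma> 1 / \<mu>)"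
    have l: "0 < l" using sigma_1 mu by (simp add: l_def)
    have s: "(\<sigma> 1)\<^sup>2 = 1 + \<mu>\<^sup>2" by (simp add: \<sigma>_def)
    have "1 / (\<sigma> 1 * l) \<le> A"
      unfolding A_def l_def[symmetric] using kappa A_bounds(1) l sigma_1
      by (intro divide_left_mono mult_pos_pos) (auto simp: A_def l_def)
    then have "1 / (\<sigma> 1 * l) * (l * (1 - \<mu>\<^sup>2 / (\<sigma> 1)\<^sup>2) / (2 * \<sigma> 1)) \<le> A * (l * (1 - \<mu>\<^sup>2 / (\<sigma> 1)\<^sup>2) / (2 * \<sigma> 1))"
      using l sigma_1 s by (intro mult_right_mono) auto
    also have "\<dots> = P1 1"
      using sigma_1 unfolding P1_def \<kappa>_def G_def l_def[symmetric]
      by (simp add: field_simps)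
    also have "1 / (\<sigma> 1 * l) * (l * (1 - \<mu>\<^sup>2 / (\<sigma> 1)\<^sup>2) / (2 * \<sigma> 1)) = (1 - \<mu>\<^sup>2 / (\<sigma> 1)\<^sup>2) / (2 * (\<sigma> 1)\<^sup>2)"
      using l sigma_1 by (simp add: field_simps power2_eq_square)
    also have "\<dots> = 1 / (2 * (1 + \<mu>\<^sup>2)\<^sup>2)"
    proof -
      have "1 + \<mu>\<^sup>2 \<noteq> 0" using mu_sq(2) by linarith
      then have "1 - \<mu>\<^sup>2 / (1 + \<mu>\<^sup>2) = 1 / (1 + \<mu>\<^sup>2)" by (metis add_diff_cancel_right' diff_divide_distrib divide_self)
      then show ?thesis unfolding s by (simp add: power2_eq_square)
    qed
    finally have "1 / (2 * (1 + \<mu>\<^sup>2)\<^sup>2) \<le> P1 1" .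
    moreover have "1/4 \<le> 1 / (2 * (1 + \<mu>\<^sup>2)\<^sup>2)"
    proof -
      have "(1 + \<mu>\<^sup>2)\<^sup>2 \<le> (65/64)\<^sup>2" using mu_sq by (intro power_mono) auto
      then have "2 * (1 + \<mu>\<^sup>2)\<^sup>2 \<le> 4" by (simp add: power2_eq_square)
      moreover have "0 < (1 + \<mu>\<^sup>2)\<^sup>2" using mu_sq(2) by (intro zero_less_power) linarith
      ultimately show ?thesis by (intro divide_left_mono) auto
    qed
    ultimately show ?thesis by linarith
  qed
  ultimately show ?thesis by linarith
qed

lemma P_bounds:
  assumes "0 \<le> t" "t \<le> 1"
  shows "0 \<le> P t" "(1 - t) / 4 \<le> 1 - P t"
proof -
  have mono: "P a - a / 4 \<le> P b - b / 4" if "0 \<le> a" "a \<le> b" "b \<le> 1" for a b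
  proof (rule DERIV_nonneg_imp_nondecreasing[OF that(2)])
    fix x assume x: "a \<le> x" "x \<le> b"
    have "((\<lambda>x. P x - x / 4) has_real_derivative P1 x - 1 / 4) (at x)"
      using x that by (auto intro!: derivative_eq_intros P_has_derivative nonneg_gt)
    then show "\<exists>y. DERIV (\<lambda>x. P x - x / 4) x :> y \<and> 0 \<le> y"
      using P1_ge[of x] x that by force
  qed
  from mono[of 0 t] mono[of t 1] assms show "0 \<le> P t" "(1 - t) / 4 \<le> 1 - P t"
    by (auto simp: P_0 P_1)
qed

text \<open>\<open>G\<close> is nonincreasing and \<open>G s - 5/2 / s\<close> nondecreasing, which
  bounds \<open>G (\<sigma> t) - G (\<sigma> 1)\<close> by a multiple of
  \<open>1 / \<sigma> t - 1 / \<sigma> 1\<close>. The numerator of the latter contains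
  \<open>(\<sigma> 1)^2 - (\<sigma> t)^2 = 1 - t\<close>, the factor that later cancels the zero of
  \<open>\<phi>\<close> on the boundary.\<close>

lemma flat_bounds:
  assumes t: "0 \<le> t" "t \<le> 1"
  shows "\<bar>4 * t * P2 t + 2 * P1 t\<bar> \<le> 5/2 * A * (1 - t) / \<sigma> t"
proof -
  \<comment> \<open>\<open>G1\<close> is the derivative of \<open>G\<close>. The constant 5/2 is
    \<open>3 * 1/2 + 1\<close>, with the 1/2 from \<open>ln_sigma\<close>.\<close>
  define G1 where "G1 s = \<mu>\<^sup>2 * (1 - 3 * ln (s / \<mu>)) / s ^ 4 - 1 / s\<^sup>2" for s
  have dG: "(G has_real_derivative G1 s) (at s)" if "\<mu> \<le> s" for s
  proof -
    have "0 < s / \<mu>" "0 < s" using that mu by auto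
    then show ?thesis unfolding G_def[abs_def] G1_def using mu
      by (auto intro!: derivative_eq_intros simp: field_simps power2_eq_square power4_eq_xxxx)
  qed
  have G1: "- 5/2 / s\<^sup>2 \<le> G1 s" "G1 s \<le> 0" if s: "\<mu> \<le> s" for s
  proof -
    have s2: "0 < s\<^sup>2" using s mu by auto
    have *: "G1 s = (\<mu>\<^sup>2 / s\<^sup>2 - 3 * (\<mu>\<^sup>2 * ln (s / \<mu>) / s\<^sup>2) - 1) / s\<^sup>2"
      using s mu by (simp add: G1_def field_simps power2_eq_square power4_eq_xxxx)
    have q: "0 \<le> \<mu>\<^sup>2 / s\<^sup>2" "\<mu>\<^sup>2 / s\<^sup>2 \<le> 1" using s mu by (auto intro: power_mono)
    have q': "0 \<le> \<mu>\<^sup>2 * ln (s / \<mu>) / s\<^sup>2" using ln_sigma(1)[OF s] by simp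
    show "- 5/2 / s\<^sup>2 \<le> G1 s"
      unfolding * by (rule divide_right_mono) (use q q' ln_sigma(2)[OF s] s2 in linarith)+
    show "G1 s \<le> 0"
      unfolding * by (rule divide_nonpos_pos) (use q q' s2 in linarith)+
  qed
  have s: "\<mu> \<le> \<sigma> t" "\<sigma> t \<le> \<sigma> 1" using t sigma_ge sigma_mono by auto
  have pos: "0 < \<sigma> t" "1 \<le> \<sigma> 1" using s mu sigma_1 by auto
  have lower: "G (\<sigma> 1) \<le> G (\<sigma> t)"
    by (rule DERIV_nonpos_imp_nonincreasing[OF s(2)]) (use dG G1 s in \<open>meson order_trans\<close>)
  have "G (\<sigma> t) - 5/2 / \<sigma> t \<le> G (\<sigma> 1) - 5/2 / \<sigma> 1"
  proof (rule DERIV_nonneg_imp_nondecreasing[OF s(2)])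
    fix x assume "\<sigma> t \<le> x"
    then have x: "\<mu> \<le> x" "0 < x" using s pos by auto
    have "((\<lambda>x. G x - 5/2 / x) has_real_derivative G1 x - (- 5/2 / x\<^sup>2)) (at x)"
      using x by (auto intro!: derivative_eq_intros dG simp: power2_eq_square)
    with G1[OF x(1)] show "\<exists>y. DERIV (\<lambda>x. G x - 5/2 / x) x :> y \<and> 0 \<le> y"
      by (metis diff_ge_0_iff_ge)
  qed
  then have "G (\<sigma> t) - G (\<sigma> 1) \<le> 5/2 * (1 / \<sigma> t - 1 / \<sigma> 1)" by simp
  also have "1 / \<sigma> t - 1 / \<sigma> 1 = ((\<sigma> 1)\<^sup>2 - (\<sigma> t)\<^sup>2) / \<sigma> t / (\<sigma> 1 * (\<sigma> t + \<sigma> 1))"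
    using pos by (simp add: divide_simps) (simp add: algebra_simps power2_eq_square)
  also have "(\<sigma> 1)\<^sup>2 - (\<sigma> t)\<^sup>2 = 1 - t" using t by (simp add: \<sigma>_def)
  also have "(1 - t) / \<sigma> t / (\<sigma> 1 * (\<sigma> t + \<sigma> 1)) \<le> (1 - t) / \<sigma> t / 1"
  proof (rule divide_left_mono)
    have "1 * 1 \<le> \<sigma> 1 * (\<sigma> t + \<sigma> 1)" using pos by (intro mult_mono) auto
    then show "1 \<le> \<sigma> 1 * (\<sigma> t + \<sigma> 1)" by simp
  qed (use t pos in auto)
  finally have "G (\<sigma> t) - G (\<sigma> 1) \<le> 5/2 * ((1 - t) / \<sigma> t)" by simp
  then have "A * (G (\<sigma> t) - G (\<sigma> 1)) \<le> A * (5/2 * ((1 - t) / \<sigma> t))"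
    using A_bounds(1) by (intro mult_left_mono) auto
  moreover have "0 \<le> A * (G (\<sigma> t) - G (\<sigma> 1))" using lower A_bounds(1) by simp
  ultimately show ?thesis
    unfolding flat_identity[OF nonneg_gt[OF t(1)]] by (simp add: mult_ac)
qed

text \<open>Compares \<open>\<rho>'\<close> with 1 and \<open>\<rho>\<close> with the radius. The
  error \<open>A / \<sigma> t\<close> need not be small near the origin, but the integral of its
  cube is of order \<open>A^3 * L\<close>, that is \<open>1 / L^2\<close>.\<close>

lemma near_sqrt:
  assumes t: "0 \<le> t" "t \<le> 1"
  shows "\<bar>2 * sqrt t * P1 t - 1\<bar> \<le> 9 * A / \<sigma> t" "\<bar>P t - sqrt t\<bar> \<le> 9 * A / \<sigma> t"
    "2 * sqrt t * P1 t \<le> 5"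
proof -
  define s where "s = \<sigma> t"
  define r where "r = sqrt t"
  define i where "i = 1 / s"
  have s: "0 < s" "s \<le> 65/64" "\<mu> \<le> s"
    using t sigma_ge[of t] mu sigma_mono[of t 1] sigma_1 mu_sq by (auto simp: s_def)
  have r: "0 \<le> r" "r \<le> s" "s - r \<le> \<mu>" "r \<le> 1" "r * r = t"
    using t mu sqrt_add_le_add_sqrt[of t "\<mu>\<^sup>2"] by (auto simp: r_def s_def \<sigma>_def)
  have A: "0 < A" using A_bounds(1) .
  have ln: "A * \<bar>ln s\<bar> \<le> A * (s + i)"
    using abs_ln_le[OF s(1)] A by (intro mult_left_mono) (auto simp: i_def)
  have inv: "64/65 \<le> i" using s by (simp add: i_def field_simps)
  have E: "\<bar>A * ln (s / \<mu>) - 1\<bar> \<le> A * (s + i) + 2 * A"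
  proof -
    have "A * ln (s / \<mu>) - 1 = A * ln s + (A * L - 1)"
      by (simp add: ln_div_mu[OF s(1)] algebra_simps)
    moreover have "\<bar>A * ln s\<bar> \<le> A * (s + i)" using ln A by (simp add: abs_mult)
    ultimately show ?thesis using A_bounds(4) by linarith
  qed
  define q where "q = r / s"
  have q: "0 \<le> q" "q \<le> 1" "1 - q \<le> 2 * (A * i)"
  proof -
    show "0 \<le> q" "q \<le> 1" using r s by (auto simp: q_def)
    have "1 - q = (s - r) / s" using s by (simp add: q_def field_simps)
    also have "\<dots> \<le> 2 * A / s" using r A_bounds(5) s by (intro divide_right_mono) auto
    finally show "1 - q \<le> 2 * (A * i)" by (simp add: i_def)
  qed
  have As: "A * s \<le> A * (65/64)" "A * (64/65) \<le> A * i"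
    by (rule mult_left_mono[OF s(2)] mult_left_mono[OF inv], use A in simp)+
  have k: "0 \<le> A * \<kappa> * r" "A * \<kappa> * r \<le> A * (3/4)" "0 \<le> A * \<kappa> * t" "A * \<kappa> * t \<le> A * (3/4)"
  proof -
    show "0 \<le> A * \<kappa> * r" "0 \<le> A * \<kappa> * t" using A kappa r t by auto
    have "A * (\<kappa> * r) \<le> A * (3/4 * 1)" "A * (\<kappa> * t) \<le> A * (3/4 * 1)"
      by (intro mult_left_mono mult_mono; use A kappa r t in simp)+
    then show "A * \<kappa> * r \<le> A * (3/4)" "A * \<kappa> * t \<le> A * (3/4)" by (auto simp: mult_ac)
  qed
  \<comment> \<open>The slope deviates from 1 for three reasons: \<open>X\<close>, which is
    \<open>A * L - 1\<close> plus \<open>A * ln s\<close>; the ratio \<open>q\<close> of the radius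
    to \<open>s\<close>; and terms of order \<open>A\<close>, one of them from
    \<open>\<kappa>\<close>.\<close>
  define X where "X = A * ln (s / \<mu>) - 1"
  have E: "\<bar>X\<bar> \<le> A * (s + i) + 2 * A" using E by (simp only: X_def)
  have "2 * r * P1 t - 1 = q * X + q * A - (1 - q) - 2 * (A * \<kappa> * r)"
    using s by (simp add: P1_def s_def[symmetric] q_def X_def field_simps)
  moreover have "\<bar>q * X\<bar> \<le> 1 * (A * (s + i) + 2 * A)"
    unfolding abs_mult using q E by (intro mult_mono) auto
  moreover have "0 \<le> q * A" "q * A \<le> 1 * A" using q A by (auto intro: mult_right_mono)
  moreover have "0 \<le> A * i" using A inv by simp
  ultimately have "\<bar>2 * r * P1 t - 1\<bar> \<le> A * (s + i) + 2 * A + A + 2 * (A * i) + 2 * (A * (3/4))"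
    using k(1,2) q A by (smt (verit, ccfv_threshold))
  also have "\<dots> \<le> 9 * (A * i)"
    using As A unfolding distrib_left by linarith
  finally show "\<bar>2 * sqrt t * P1 t - 1\<bar> \<le> 9 * A / \<sigma> t" by (simp add: r_def s_def i_def)

  have "P t - r = s * X + (s - r) - A * \<kappa> * t"
    by (simp add: P_def s_def[symmetric] X_def algebra_simps)
  moreover have "\<bar>s * X\<bar> \<le> s * (A * (s + i) + 2 * A)"
    unfolding abs_mult using s E by (intro mult_mono) auto
  moreover have "s * (A * (s + i) + 2 * A) = A * s * s + A + 2 * (A * s)"
    using s by (simp add: i_def field_simps)
  moreover have "A * s * s \<le> A * (65/64) * (65/64)"
    using s A by (intro mult_mono) auto
  ultimately have "\<bar>P t - r\<bar> \<le> 9 * (A * i)"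
    using k r A_bounds(5) As A by linarith
  then show "\<bar>P t - sqrt t\<bar> \<le> 9 * A / \<sigma> t" by (simp add: r_def s_def i_def)

  have "q * (A * (ln (s / \<mu>) + 1)) \<le> 1 * (A * (ln (\<sigma> 1 / \<mu>) + 1))"
  proof (rule mult_mono)
    have "ln (s / \<mu>) \<le> ln (\<sigma> 1 / \<mu>)"
      using s mu sigma_mono[of t 1] t sigma_1 by (auto simp: s_def divide_right_mono)
    then show "A * (ln (s / \<mu>) + 1) \<le> A * (ln (\<sigma> 1 / \<mu>) + 1)" using A by (intro mult_left_mono) auto
    show "0 \<le> A * (ln (s / \<mu>) + 1)" using A ln_sigma(1)[OF s(3)] by simp
  qed (use q in auto)
  also have "\<dots> = A * ln (\<sigma> 1) + A * L + A"
    using sigma_1 ln_div_mu[of "\<sigma> 1"] by (simp add: algebra_simps)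
  also have "\<dots> \<le> 5"
  proof -
    have "A * ln (\<sigma> 1) \<le> 1 * 1"
      using A A_bounds sigma_1 mu_sq ln_le_minus_one[of "\<sigma> 1"] by (intro mult_mono) auto
    then show ?thesis using A_bounds by linarith
  qed
  finally have "q * (A * (ln (s / \<mu>) + 1)) \<le> 5" .
  moreover have "2 * r * P1 t = q * (A * (ln (s / \<mu>) + 1)) - 2 * (A * \<kappa> * r)"
    using s by (simp add: P1_def s_def[symmetric] q_def field_simps)
  ultimately show "2 * sqrt t * P1 t \<le> 5" using k by (simp add: r_def)
qed

section \<open>Lipschitz regularity of the flattened radius\<close>

lemma bdd_lipschitz_sigma: "bdd_lipschitz \<sigma>" "bdd_lipschitz (\<lambda>t. 1 / \<sigma> t)" "bdd_lipschitz (\<lambda>t. ln (\<sigma> t / \<mu>))"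
proof -
  have pos: "0 < \<sigma> t" if "t \<in> {0..1}" for t using that by (auto intro!: sigma_pos nonneg_gt)
  have c: "continuous_on {0..1} \<sigma>" unfolding \<sigma>_def[abs_def] by (intro continuous_intros)
  show s: "bdd_lipschitz \<sigma>"
  proof (rule bdd_lipschitz_C1)
    show "(\<sigma> has_real_derivative 1 / (2 * \<sigma> t)) (at t)" if "t \<in> {0..1}" for t
      using that by (intro sigma_has_derivative nonneg_gt) auto
    show "continuous_on {0..1} (\<lambda>t. 1 / (2 * \<sigma> t))"
      using pos by (intro continuous_intros c) (auto simp: less_imp_neq[symmetric])
  qed
  show "bdd_lipschitz (\<lambda>t. 1 / \<sigma> t)"
    by (rule bdd_lipschitz_divide[OF bdd_lipschitz_const s mu(1)]) (use sigma_ge in auto)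
  show "bdd_lipschitz (\<lambda>t. ln (\<sigma> t / \<mu>))"
  proof (rule bdd_lipschitz_C1)
    fix t :: real assume t: "t \<in> {0..1}"
    have "0 < \<sigma> t / \<mu>" using pos[OF t] mu by simp
    then show "((\<lambda>t. ln (\<sigma> t / \<mu>)) has_real_derivative 1 / (2 * \<sigma> t * \<sigma> t)) (at t)"
      using t pos[OF t] mu nonneg_gt[of t]
      by (auto intro!: derivative_eq_intros sigma_has_derivative simp: field_simps)
  next
    show "continuous_on {0..1} (\<lambda>t. 1 / (2 * \<sigma> t * \<sigma> t))"
      using pos by (intro continuous_intros c) (auto simp: less_imp_neq[symmetric])
  qed
qed

lemma bdd_lipschitz_P: "bdd_lipschitz P" "bdd_lipschitz P1" "bdd_lipschitz P2"
proof -
  have *: "P = (\<lambda>t. A * (\<sigma> t * ln (\<sigma> t / \<mu>) - \<kappa> * t))"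
    "P1 = (\<lambda>t. A * ((ln (\<sigma> t / \<mu>) + 1) * (1 / \<sigma> t) * (1/2) - \<kappa>))"
    "P2 = (\<lambda>t. - A * ln (\<sigma> t / \<mu>) * (1/4) * (1 / \<sigma> t) ^ 3)"
    by (auto simp: P_def P1_def P2_def fun_eq_iff power_divide)
  show "bdd_lipschitz P" "bdd_lipschitz P1" "bdd_lipschitz P2"
    unfolding * by (intro bdd_lipschitz_intros bdd_lipschitz_sigma)+
qed

text \<open>The choice of \<open>\<kappa>\<close> makes the numerator vanish at
  \<open>t = 1\<close>, so \<open>bdd_lipschitz_quotient\<close> applies. \<open>P3\<close> is the
  third derivative of \<open>P\<close>.\<close>

lemma bdd_lipschitz_flat: "bdd_lipschitz (\<lambda>t. (4 * t * P2 t + 2 * P1 t) / (1 - t))"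
proof -
  define P3 where "P3 t = - A * (1 - 3 * ln (\<sigma> t / \<mu>)) * (1/8) * (1 / \<sigma> t) ^ 5" for t
  have d: "(P2 has_real_derivative P3 t) (at t)" if t: "- (\<mu>\<^sup>2) < t" for t
  proof -
    have "0 < \<sigma> t / \<mu>" using sigma_pos[OF t] mu by simp
    then show ?thesis
      unfolding P2_def[abs_def] P3_def using sigma_pos[OF t] mu
      by (auto intro!: derivative_eq_intros sigma_has_derivative[OF t]
          simp: field_simps eval_nat_numeral)
  qed
  have dF: "((\<lambda>t. 4 * t * P2 t + 2 * P1 t) has_real_derivative 6 * P2 t + 4 * t * P3 t) (at t)"
    if "t \<in> {0..1}" for t
    using that by (auto intro!: derivative_eq_intros d P1_has_derivative nonneg_gt)
  show ?thesis
  proof (rule bdd_lipschitz_quotient)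
    show "continuous_on {0..1} (\<lambda>t. 4 * t * P2 t + 2 * P1 t)"
      by (rule DERIV_continuous_on[OF has_field_derivative_at_within[OF dF]])
    show "4 * 1 * P2 1 + 2 * P1 1 = 0" using flat_identity[OF nonneg_gt[of 1]] by simp
    show "bdd_lipschitz (\<lambda>t. 6 * P2 t + 4 * t * P3 t)"
      unfolding P3_def by (intro bdd_lipschitz_intros bdd_lipschitz_P bdd_lipschitz_sigma)
  qed (use dF in auto)
qed

end

subsection \<open>A bubble times the profile\<close>

text \<open>The derivatives are required on a symmetric interval since \<open>P 0 = 0\<close> and
  composition with \<open>P\<close> needs two-sided derivatives at 0. \<open>M\<close> is a
  parameter, so that a single \<open>M\<close> can serve all \<open>\<mu>\<close>.\<close>

locale bubble_profile = log_flattening +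
  fixes K W W1 :: "real \<Rightarrow> real" and M :: real
  assumes W_deriv: "\<And>r. r \<in> {-1<..<1} \<Longrightarrow> (W has_real_derivative W1 r) (at r)"
    and W1_deriv: "\<And>r. r \<in> {-1<..<1} \<Longrightarrow> (W1 has_real_derivative K r * W r) (at r)"
    and W_cont: "continuous_on {0..1} W"
    and W_ge: "\<And>r. r \<in> {0..1} \<Longrightarrow> 1 - r \<le> W r"
    and W_1: "W 1 = 0"
    and bound: "\<And>r. r \<in> {0..1} \<Longrightarrow> \<bar>K r\<bar> \<le> M" "\<And>r. r \<in> {0..1} \<Longrightarrow> \<bar>W1 r\<bar> \<le> M"
    and lip: "\<And>r s. r \<in> {0..1} \<Longrightarrow> s \<in> {0..1} \<Longrightarrow> \<bar>K r - K s\<bar> \<le> M * \<bar>r - s\<bar>"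
      "\<And>r s. r \<in> {0..1} \<Longrightarrow> s \<in> {0..1} \<Longrightarrow> \<bar>W r - W s\<bar> \<le> M * \<bar>r - s\<bar>"
      "\<And>r s. r \<in> {0..1} \<Longrightarrow> s \<in> {0..1} \<Longrightarrow> \<bar>W1 r - W1 s\<bar> \<le> M * \<bar>r - s\<bar>"
begin

definition "\<phi> t = W (P t)"
definition "\<phi>1 t = W1 (P t) * P1 t"
definition "\<phi>2 t = K (P t) * W (P t) * (P1 t)\<^sup>2 + W1 (P t) * P2 t"

text \<open>Without its last summand \<open>q\<close> is the one of the standard bubble of width \<open>l\<close>. That summand makes
  \<open>q\<close> and \<open>t q'\<close> satisfy \<open>q - t q' = l\<^sup>2 (1 - t\<^sup>2)\<close>, so that the cross term of
  \<open>g\<close> and \<open>\<phi>\<close> in the Laplacian of their product vanishes on the boundary, where it is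
  divided by \<open>\<phi>\<close>.\<close>

definition q :: "real \<Rightarrow> real \<Rightarrow> real" where "q l t = t + l\<^sup>2 + l\<^sup>2 * t\<^sup>2"
definition g :: "real \<Rightarrow> real \<Rightarrow> real" where "g l t = 1 / sqrt (q l t)"
definition g1 :: "real \<Rightarrow> real \<Rightarrow> real" where
  "g1 l t = - g l t * (1 + 2 * l\<^sup>2 * t) / (2 * q l t)"
definition g2 :: "real \<Rightarrow> real \<Rightarrow> real" where
  "g2 l t = g l t * (3/4 * (1 + 2 * l\<^sup>2 * t)\<^sup>2 / (q l t)\<^sup>2 - l\<^sup>2 / q l t)"

text \<open>With \<open>t + l^2\<close> in place of \<open>q l t\<close>,
  \<open>root 4 (3 * l^2) * g l t\<close> would be the standard bubble, which solves the equation
  without potential. Dividing by \<open>\<phi> 0\<close> compensates the factor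
  \<open>\<phi>\<close> at the centre.\<close>

definition c :: "real \<Rightarrow> real" where "c l = root 4 (3 * l\<^sup>2 / \<phi> 0 ^ 4)"
definition "f l t = c l * (g l t * \<phi> t)"
definition "f1 l t = c l * (g1 l t * \<phi> t + g l t * \<phi>1 t)"
definition "f2 l t = c l * (g2 l t * \<phi> t + 2 * g1 l t * \<phi>1 t + g l t * \<phi>2 t)"

text \<open>\<open>f\<^sup>4 + (4 t f'' + 6 f') / f\<close>, written without \<open>f\<close>: the summands are the defect of
  \<open>g\<close> as a bubble, the effect of \<open>\<phi>\<close> on the nonlinearity, and the contributions of
  \<open>W''\<close> and \<open>W'\<close>.\<close>

definition k :: "real \<Rightarrow> real \<Rightarrow> real" where
  "k l t = (- l\<^sup>2 * t\<^sup>2 - 10 * l ^ 4 * t + 2 * l ^ 4 * t ^ 3) / (q l t)\<^sup>2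
    + 3 * l\<^sup>2 / \<phi> 0 ^ 4 * (\<phi> t ^ 4 - \<phi> 0 ^ 4) / (q l t)\<^sup>2
    + 4 * t * (P1 t)\<^sup>2 * K (P t)
    + W1 (P t) / \<phi> t * (4 * t * P2 t + 2 * P1 t + 4 * l\<^sup>2 * (1 - t\<^sup>2) * P1 t / q l t)"

lemma P_range: "t \<in> {0..<1} \<Longrightarrow> P t \<in> {0..<1}" "t \<in> {0..1} \<Longrightarrow> P t \<in> {0..1}"
  using P_bounds[of t] by auto

lemma phi_ge: "t \<in> {0..1} \<Longrightarrow> (1 - t) / 4 \<le> \<phi> t"
  using P_bounds[of t] W_ge[OF P_range(2)[of t]] by (auto simp: \<phi>_def)

lemma phi_pos: "t \<in> {0..<1} \<Longrightarrow> 0 < \<phi> t"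
  using phi_ge[of t] by auto

lemma phi_0: "1 \<le> \<phi> 0" and phi_1: "\<phi> 1 = 0"
  using W_ge[of 0] W_1 by (auto simp: \<phi>_def P_0 P_1)

lemma phi_has_derivative:
  assumes t: "t \<in> {0..<1}"
  shows "(\<phi> has_real_derivative \<phi>1 t) (at t)" "(\<phi>1 has_real_derivative \<phi>2 t) (at t)"
proof -
  have P: "P t \<in> {-1<..<1}" "- (\<mu>\<^sup>2) < t" using P_range(1)[OF t] t nonneg_gt[of t] by auto
  have W1P: "((\<lambda>t. W1 (P t)) has_real_derivative K (P t) * W (P t) * P1 t) (at t)"
    by (rule DERIV_chain2[OF W1_deriv[OF P(1)] P_has_derivative[OF P(2)]])
  show "(\<phi> has_real_derivative \<phi>1 t) (at t)"
    unfolding \<phi>_def[abs_def] \<phi>1_def by (rule DERIV_chain2[OF W_deriv[OF P(1)] P_has_derivative[OF P(2)]])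
  show "(\<phi>1 has_real_derivative \<phi>2 t) (at t)"
    using DERIV_mult[OF W1P P1_has_derivative[OF P(2)]]
    by (simp add: \<phi>1_def[abs_def] \<phi>2_def algebra_simps power2_eq_square)
qed

lemma phi_continuous: "continuous_on {0..1} \<phi>"
proof -
  have "continuous_on {0..1} P"
    by (rule DERIV_continuous_on[OF has_field_derivative_at_within[OF P_has_derivative[OF nonneg_gt]]]) auto
  then show ?thesis unfolding \<phi>_def[abs_def]
    by (rule continuous_on_compose2[OF W_cont]) (use P_range in auto)
qed

lemma bdd_lipschitz_profile:
  "bdd_lipschitz (\<lambda>t. K (P t))" "bdd_lipschitz (\<lambda>t. W1 (P t))" "bdd_lipschitz \<phi>"
  "bdd_lipschitz (\<lambda>t. \<phi> t / (1 - t))"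
proof -
  note comp = bdd_lipschitz_compose[OF bdd_lipschitz_P(1), of "{0..1}", OF P_range(2)]
  show "bdd_lipschitz (\<lambda>t. K (P t))" by (rule comp[OF _ lip(1)]) auto
  show W1: "bdd_lipschitz (\<lambda>t. W1 (P t))" by (rule comp[OF _ lip(3)]) auto
  show "bdd_lipschitz \<phi>" unfolding \<phi>_def[abs_def] by (rule comp[OF _ lip(2)]) auto
  show "bdd_lipschitz (\<lambda>t. \<phi> t / (1 - t))"
    by (rule bdd_lipschitz_quotient[OF phi_continuous phi_1 phi_has_derivative(1)])
      (auto simp: \<phi>1_def[abs_def] intro!: bdd_lipschitz_intros W1 bdd_lipschitz_P)
qed

context
  fixes l :: real
  assumes l: "0 < l" "l \<le> 1"
begin

lemma q_ge:
  assumes "0 \<le> t"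
  shows "t + l\<^sup>2 \<le> q l t" "l\<^sup>2 \<le> q l t" "0 < q l t"
proof -
  show "t + l\<^sup>2 \<le> q l t" by (simp add: q_def)
  then show "l\<^sup>2 \<le> q l t" using assms by linarith
  moreover have "0 < l\<^sup>2" using l by simp
  ultimately show "0 < q l t" by linarith
qed

lemma g_has_derivative:
  assumes t: "0 \<le> t"
  shows "(g l has_real_derivative g1 l t) (at t)" "(g1 l has_real_derivative g2 l t) (at t)"
proof -
  have dq: "(q l has_real_derivative 1 + 2 * l\<^sup>2 * t) (at t)" for t
    unfolding q_def[abs_def] by (auto intro!: derivative_eq_intros)
  have q: "0 < q l t" using q_ge(3)[OF t] .
  show d: "(g l has_real_derivative g1 l t) (at t)"
    unfolding g_def[abs_def] g1_def using q
    by (auto intro!: derivative_eq_intros dq simp: g_def divide_simps)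
  show "(g1 l has_real_derivative g2 l t) (at t)"
    unfolding g1_def[abs_def] g2_def using q
    by (auto intro!: derivative_eq_intros dq d simp: g1_def divide_simps)
       (simp add: algebra_simps power2_eq_square)
qed

lemma f_has_derivative:
  assumes t: "t \<in> {0..<1}"
  shows "(f l has_real_derivative f1 l t) (at t)" "(f1 l has_real_derivative f2 l t) (at t)"
proof -
  have "0 \<le> t" using t by simp
  note d = g_has_derivative[OF this] phi_has_derivative[OF t]
  show "(f l has_real_derivative f1 l t) (at t)"
    unfolding f_def[abs_def] f1_def by (auto intro!: derivative_eq_intros d)
  show "(f1 l has_real_derivative f2 l t) (at t)"
    unfolding f1_def[abs_def] f2_def by (rule derivative_eq_intros d refl)+ (simp add: algebra_simps)
qed

lemma g_continuous: "continuous_on {0..1} (g l)"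
  by (rule DERIV_continuous_on[OF has_field_derivative_at_within[OF g_has_derivative(1)]]) auto

lemma f_continuous: "continuous_on {0..1} (f l)"
  unfolding f_def[abs_def] by (intro continuous_intros g_continuous phi_continuous)

lemma f2_continuous: "continuous_on {0..<1} (f2 l)"
proof -
  note P = bdd_lipschitz_P[THEN bdd_lipschitz_continuous]
  have phi: "continuous_on {0..<1} \<phi>" "continuous_on {0..<1} \<phi>1"
    by (rule DERIV_continuous_on[OF has_field_derivative_at_within[OF phi_has_derivative(1)]]
      DERIV_continuous_on[OF has_field_derivative_at_within[OF phi_has_derivative(2)]]; simp)+
  have g: "continuous_on {0..<1} (g l)" "continuous_on {0..<1} (g1 l)"
    by (rule DERIV_continuous_on[OF has_field_derivative_at_within[OF g_has_derivative(1)]]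
      DERIV_continuous_on[OF has_field_derivative_at_within[OF g_has_derivative(2)]]; simp)+
  have q: "continuous_on {0..<1} (q l)"
    unfolding q_def[abs_def] by (intro continuous_intros)
  have g2: "continuous_on {0..<1} (g2 l)"
    unfolding g2_def[abs_def] by (intro continuous_intros g q) (use q_ge(3) in \<open>auto simp: less_imp_neq[symmetric]\<close>)
  note c = bdd_lipschitz_continuous[OF bdd_lipschitz_profile(1)] bdd_lipschitz_continuous[OF bdd_lipschitz_profile(2)]
  have "continuous_on {0..<1} \<phi>2"
    unfolding \<phi>2_def[abs_def] \<phi>_def[symmetric] by (intro continuous_intros c phi P)
  then show ?thesis
    unfolding f2_def[abs_def] by (intro continuous_intros g g2 phi)
qed

lemma c_pos: "0 < c l" and c_power: "c l ^ 4 = 3 * l\<^sup>2 / \<phi> 0 ^ 4"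
  using l phi_0 by (auto simp: c_def)

lemma f_pos: "t \<in> {0..<1} \<Longrightarrow> 0 < f l t"
  using c_pos phi_pos[of t] q_ge(3)[of t] by (auto simp: f_def g_def)

lemma f_1: "f l 1 = 0"
  by (simp add: f_def phi_1)

text \<open>The product rule sorts the Laplacian of \<open>g * \<phi>\<close> by the order of the
  derivative of \<open>\<phi>\<close>. Up to the factor \<open>g l t\<close>, \<open>e1\<close> is
  the coefficient of \<open>\<phi>\<close> and \<open>e2\<close> that of \<open>\<phi>1\<close>; the
  2 in \<open>e2\<close> joins \<open>4 * t * \<phi>2 t\<close> to form the second radial derivative
  of \<open>\<phi>\<close>.\<close>

lemma f_equation:
  assumes t: "t \<in> {0..<1}"
  shows "- (4 * t * f2 l t + 6 * f1 l t) + k l t * f l t = f l t ^ 5"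
proof -
  define Q where "Q = q l t"
  define R where "R = 1 + 2 * l\<^sup>2 * t"
  have Q: "0 < Q" using q_ge(3)[of t] t by (simp add: Q_def)
  have phi: "0 < \<phi> t" using phi_pos[OF t] .
  have g4: "g l t ^ 4 = 1 / Q\<^sup>2"
  proof -
    have "g l t ^ 4 = 1 / (sqrt Q ^ 2) ^ 2" by (simp add: g_def Q_def power_divide flip: power_mult)
    then show ?thesis using Q by simp
  qed
  have "f l t ^ 5 = f l t * (c l ^ 4 * g l t ^ 4 * \<phi> t ^ 4)"
    by (simp add: f_def power_mult_distrib eval_nat_numeral)
  then have f5: "f l t ^ 5 = c l * g l t * (3 * l\<^sup>2 / \<phi> 0 ^ 4 * \<phi> t ^ 4 / Q\<^sup>2 * \<phi> t)"
    unfolding c_power g4 by (simp add: f_def)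
  \<comment> \<open>\<open>N\<close> is the error caused by the extra summand of \<open>q\<close>;
    for \<open>t + l^2\<close> alone only \<open>- 3 * l^2\<close> would remain in
    \<open>e1\<close>.\<close>
  define N where "N = - l\<^sup>2 * t\<^sup>2 - 10 * l ^ 4 * t + 2 * l ^ 4 * t ^ 3"
  have e1: "4 * t * g2 l t + 6 * g1 l t = g l t * (N / Q\<^sup>2 - 3 * l\<^sup>2 / Q\<^sup>2)"
  proof -
    have "4 * t * g2 l t + 6 * g1 l t = g l t * ((3 * t * R\<^sup>2 - 4 * t * l\<^sup>2 * Q - 3 * R * Q) / Q\<^sup>2)"
      unfolding g1_def g2_def Q_def[symmetric] R_def[symmetric] using Q
      by (simp add: field_simps power2_eq_square)
    also have "3 * t * R\<^sup>2 - 4 * t * l\<^sup>2 * Q - 3 * R * Q = N - 3 * l\<^sup>2"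
      unfolding R_def Q_def q_def N_def by (simp add: algebra_simps eval_nat_numeral)
    finally show ?thesis by (simp add: diff_divide_distrib)
  qed
  have e2: "6 * g l t + 8 * t * g1 l t = g l t * (2 + 4 * l\<^sup>2 * (1 - t\<^sup>2) / Q)"
  proof -
    have "6 * g l t + 8 * t * g1 l t = g l t * (2 + 4 * (Q - t * R) / Q)"
      unfolding g1_def Q_def[symmetric] R_def[symmetric] using Q by (simp add: field_simps)
    also have "Q - t * R = l\<^sup>2 * (1 - t\<^sup>2)"
      unfolding R_def Q_def q_def by (simp add: algebra_simps power2_eq_square)
    finally show ?thesis by (simp add: mult_ac)
  qed
  have "4 * t * f2 l t + 6 * f1 l t
    = c l * ((4 * t * g2 l t + 6 * g1 l t) * \<phi> t + (6 * g l t + 8 * t * g1 l t) * \<phi>1 t + 4 * t * g l t * \<phi>2 t)"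
    by (simp add: f1_def f2_def algebra_simps)
  also have "\<dots> = c l * g l t * ((N / Q\<^sup>2 - 3 * l\<^sup>2 / Q\<^sup>2) * \<phi> t
      + (2 + 4 * l\<^sup>2 * (1 - t\<^sup>2) / Q) * \<phi>1 t + 4 * t * \<phi>2 t)"
    unfolding e1 e2 by (simp add: algebra_simps)
  finally have lhs: "4 * t * f2 l t + 6 * f1 l t = \<dots>" .
  have kf: "k l t * f l t = c l * g l t * (N / Q\<^sup>2 * \<phi> t
      + 3 * l\<^sup>2 / \<phi> 0 ^ 4 * (\<phi> t ^ 4 - \<phi> 0 ^ 4) / Q\<^sup>2 * \<phi> t
      + 4 * t * (P1 t)\<^sup>2 * K (P t) * \<phi> t
      + W1 (P t) * (4 * t * P2 t + 2 * P1 t + 4 * l\<^sup>2 * (1 - t\<^sup>2) * P1 t / Q))"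
    unfolding k_def N_def[symmetric] Q_def[symmetric] f_def using phi
    by (simp add: algebra_simps)
  \<comment> \<open>By the normalisation of \<open>c\<close>, the bubble term is the nonlinear one
    with \<open>\<phi> t\<close> replaced by \<open>\<phi> 0\<close>. Only a difference of fourth
    powers, which vanishes at the centre, is left to the potential.\<close>
  have key: "3 * l\<^sup>2 / \<phi> 0 ^ 4 * (\<phi> t ^ 4 - \<phi> 0 ^ 4) / Q\<^sup>2 = 3 * l\<^sup>2 / \<phi> 0 ^ 4 * \<phi> t ^ 4 / Q\<^sup>2 - 3 * l\<^sup>2 / Q\<^sup>2"
  proof -
    have "3 * l\<^sup>2 / \<phi> 0 ^ 4 * (\<phi> t ^ 4 - \<phi> 0 ^ 4) = 3 * l\<^sup>2 / \<phi> 0 ^ 4 * \<phi> t ^ 4 - 3 * l\<^sup>2"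
      using phi_0 by (simp add: right_diff_distrib)
    then show ?thesis by (simp add: diff_divide_distrib)
  qed
  show ?thesis
    unfolding lhs kf key f5 \<phi>1_def \<phi>2_def \<phi>_def[symmetric] by (simp add: algebra_simps)
qed

text \<open>The only singular division is that by \<open>\<phi> t\<close>, at \<open>t = 1\<close>.
  There numerator and denominator are both divided by \<open>1 - t\<close>: both quotients are
  bounded Lipschitz, and \<open>\<phi> t / (1 - t)\<close> is at least 1/4.\<close>

lemma bdd_lipschitz_k: "bdd_lipschitz (k l)"
proof (rule bdd_lipschitz_cong)
  have q: "bdd_lipschitz (q l)" unfolding q_def[abs_def] by (intro bdd_lipschitz_intros)
  have iq: "bdd_lipschitz (\<lambda>t. inverse (q l t))"
    by (rule bdd_lipschitz_inverse[OF q, of "l\<^sup>2"]) (use l q_ge in auto)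
  have ip: "bdd_lipschitz (\<lambda>t. inverse (\<phi> t / (1 - t)))"
    by (rule bdd_lipschitz_inverse[OF bdd_lipschitz_profile(4), of "1/4"])
      (use phi_ge in \<open>auto simp: field_simps\<close>)
  show "bdd_lipschitz (\<lambda>t. (- l\<^sup>2 * t\<^sup>2 - 10 * l ^ 4 * t + 2 * l ^ 4 * t ^ 3) * (inverse (q l t))\<^sup>2
    + 3 * l\<^sup>2 / \<phi> 0 ^ 4 * (\<phi> t ^ 4 - \<phi> 0 ^ 4) * (inverse (q l t))\<^sup>2
    + 4 * t * (P1 t)\<^sup>2 * K (P t)
    + W1 (P t) * inverse (\<phi> t / (1 - t)) *
      ((4 * t * P2 t + 2 * P1 t) / (1 - t) + 4 * l\<^sup>2 * (1 + t) * P1 t * inverse (q l t)))"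
    by (intro bdd_lipschitz_intros iq ip bdd_lipschitz_profile bdd_lipschitz_P bdd_lipschitz_flat)
next
  fix t :: real assume t: "t \<in> {0..<1}"
  have eq: "inverse (\<phi> t / (1 - t)) * (F / (1 - t) + a * (1 + t) * b * inverse (q l t))
      = 1 / \<phi> t * (F + a * (1 - t\<^sup>2) * b / q l t)" for F a b
    using t phi_pos[OF t] q_ge(3)[of t] by (simp add: divide_simps) (simp add: algebra_simps power2_eq_square)
  show "(- l\<^sup>2 * t\<^sup>2 - 10 * l ^ 4 * t + 2 * l ^ 4 * t ^ 3) * (inverse (q l t))\<^sup>2
    + 3 * l\<^sup>2 / \<phi> 0 ^ 4 * (\<phi> t ^ 4 - \<phi> 0 ^ 4) * (inverse (q l t))\<^sup>2
    + 4 * t * (P1 t)\<^sup>2 * K (P t)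
    + W1 (P t) * inverse (\<phi> t / (1 - t)) *
      ((4 * t * P2 t + 2 * P1 t) / (1 - t) + 4 * l\<^sup>2 * (1 + t) * P1 t * inverse (q l t)) = k l t"
    unfolding k_def mult.assoc[of "W1 (P t)" "inverse _"] eq
    by (simp add: divide_inverse power_inverse)
qed

end

text \<open>The first error comes from the flattening, the second from the width of the bubble.
  \<open>C\<close> may depend on \<open>\<mu>\<close> but not on \<open>l\<close>, so
  \<open>\<mu>\<close> has to be fixed first and \<open>l\<close> afterwards.\<close>

lemma k_estimate:
  obtains C where "0 \<le> C"
    "\<And>l t. 0 < l \<Longrightarrow> l \<le> 1 \<Longrightarrow> t \<in> {0..<1} \<Longrightarrow>
      \<bar>k l t - K (sqrt t)\<bar> \<le> 73 * M * A / \<sigma> t + C * l / sqrt (t + l\<^sup>2)"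
proof -
  obtain C1 where C1: "0 < C1" "\<And>t. t \<in> {0..<1} \<Longrightarrow> \<bar>P1 t\<bar> \<le> C1"
    "\<And>x y. x \<in> {0..<1} \<Longrightarrow> y \<in> {0..<1} \<Longrightarrow> \<bar>P1 x - P1 y\<bar> \<le> C1 * \<bar>x - y\<bar>"
    by (rule bdd_lipschitzE[OF bdd_lipschitz_P(2)]) blast
  have phi4: "bdd_lipschitz (\<lambda>t. \<phi> t ^ 4)" by (intro bdd_lipschitz_intros bdd_lipschitz_profile)
  obtain C2 where C2: "0 < C2" "\<And>x. x \<in> {0..<1} \<Longrightarrow> \<bar>\<phi> x ^ 4\<bar> \<le> C2"
    "\<And>x y. x \<in> {0..<1} \<Longrightarrow> y \<in> {0..<1} \<Longrightarrow> \<bar>\<phi> x ^ 4 - \<phi> y ^ 4\<bar> \<le> C2 * \<bar>x - y\<bar>"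
    by (rule bdd_lipschitzE[OF phi4]) blast
  have M: "0 \<le> M" using bound(1)[of 0] by auto
  show ?thesis
  proof (rule that)
    show "0 \<le> 12 + 3 * C2 + 32 * M * C1" using C1 C2 M by auto
    fix l t :: real assume l: "0 < l" "l \<le> 1" and t: "t \<in> {0..<1}"
    define Q where "Q = q l t"
    \<comment> \<open>All terms due to \<open>l\<close> are bounded by multiples of
      \<open>d\<close>, the square of \<open>l / sqrt (t + l^2)\<close>; this quotient is at most 1
      and hence also bounds \<open>d\<close>.\<close>
    define d where "d = l\<^sup>2 / (t + l\<^sup>2)"
    have l2: "0 < l\<^sup>2" "l\<^sup>2 \<le> 1" using l by (auto simp: power_le_one)
    have tl: "0 < t + l\<^sup>2" "t + l\<^sup>2 \<le> 2"
      using t l2 by (auto intro: add_nonneg_pos)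
    have Q: "0 < Q" "t + l\<^sup>2 \<le> Q" using q_ge[OF l, of t] t by (auto simp: Q_def)
    have lQ: "l\<^sup>2 / Q \<le> d" unfolding d_def using Q l2 tl by (intro divide_left_mono) auto
    have s: "0 < \<sigma> t" using t by (intro sigma_pos nonneg_gt) auto
    have phi: "0 < \<phi> t" "(1 - t) / 4 \<le> \<phi> t" using phi_pos[OF t] phi_ge[of t] t by auto
    have A: "0 < A" using A_bounds(1) .
    have As: "0 \<le> A / \<sigma> t" using A s by simp
    have r: "P t \<in> {0..1}" "sqrt t \<in> {0..1}" using P_range(1)[OF t] t by auto
    have P1: "0 \<le> P1 t" "P1 t \<le> C1" using P1_ge[of t] C1(2)[OF t] t by auto

    have "l\<^sup>2 * 1 \<le> l\<^sup>2 * (2 / (t + l\<^sup>2))"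
      using l2 tl by (intro mult_left_mono) auto
    then have ld: "l\<^sup>2 \<le> 2 * d" by (simp add: d_def mult.commute)
    have d0: "0 \<le> d" using tl by (simp add: d_def)
    have tpow: "0 \<le> t\<^sup>2" "0 \<le> t ^ 3" "t ^ 3 \<le> t"
      using t power_decreasing[of 1 3 t] by auto
    have e1: "\<bar>(- l\<^sup>2 * t\<^sup>2 - 10 * l ^ 4 * t + 2 * l ^ 4 * t ^ 3) / Q\<^sup>2\<bar> \<le> 12 * d"
    proof -
      \<comment> \<open>Nonnegative terms, among them \<open>6 * l^6\<close>, are added in order to
        reach \<open>6 * l^2 * (t + l^2)^2\<close>.\<close>
      have "l ^ 4 * t ^ 3 \<le> l ^ 4 * t" "0 \<le> l\<^sup>2 * t\<^sup>2" "0 \<le> l ^ 4 * t" "0 \<le> l ^ 4 * t ^ 3" "0 \<le> l ^ 6"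
        using l t tpow by (auto intro!: mult_left_mono)
      then have "\<bar>- l\<^sup>2 * t\<^sup>2 - 10 * l ^ 4 * t + 2 * l ^ 4 * t ^ 3\<bar> \<le> 6 * (l\<^sup>2 * t\<^sup>2) + 12 * (l ^ 4 * t) + 6 * l ^ 6"
        by linarith
      also have "\<dots> = 6 * l\<^sup>2 * (t + l\<^sup>2)\<^sup>2"
        by (simp add: algebra_simps eval_nat_numeral)
      also have "\<dots> \<le> 6 * l\<^sup>2 * Q\<^sup>2"
        using Q tl by (intro mult_left_mono power_mono) auto
      finally have "\<bar>(- l\<^sup>2 * t\<^sup>2 - 10 * l ^ 4 * t + 2 * l ^ 4 * t ^ 3) / Q\<^sup>2\<bar> \<le> 6 * l\<^sup>2"
        using Q by (simp add: abs_divide pos_divide_le_eq)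
      then show ?thesis using ld by linarith
    qed
    have e2: "\<bar>3 * l\<^sup>2 / \<phi> 0 ^ 4 * (\<phi> t ^ 4 - \<phi> 0 ^ 4) / Q\<^sup>2\<bar> \<le> 3 * C2 * d"
    proof -
      have "3 * l\<^sup>2 / \<phi> 0 ^ 4 * (\<phi> t ^ 4 - \<phi> 0 ^ 4) / Q\<^sup>2
        = 3 * (1 / \<phi> 0 ^ 4) * ((\<phi> t ^ 4 - \<phi> 0 ^ 4) / Q) * (l\<^sup>2 / Q)"
        by (simp add: divide_inverse power2_eq_square mult_ac)
      also have "\<bar>\<dots>\<bar> \<le> 3 * 1 * C2 * d"
        unfolding abs_mult
      proof (intro mult_mono)
        show "\<bar>1 / \<phi> 0 ^ 4\<bar> \<le> 1" using phi_0 one_le_power[OF phi_0, of 4] by (simp add: abs_divide)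
        have "\<bar>\<phi> t ^ 4 - \<phi> 0 ^ 4\<bar> \<le> C2 * t" using C2(3)[OF t, of 0] t by auto
        also have "\<dots> \<le> C2 * Q" by (rule mult_left_mono) (use C2(1) Q l2 in linarith)+
        finally show "\<bar>(\<phi> t ^ 4 - \<phi> 0 ^ 4) / Q\<bar> \<le> C2" using Q by (simp add: abs_divide pos_divide_le_eq)
        show "\<bar>l\<^sup>2 / Q\<bar> \<le> d" using lQ Q l2 by simp
      qed (use C2(1) d0 in auto)
      finally show ?thesis by simp
    qed
    have W1: "\<bar>W1 (P t)\<bar> \<le> M" by (rule bound(2)[OF r(1)])
    have e3: "\<bar>W1 (P t) / \<phi> t * (4 * l\<^sup>2 * (1 - t\<^sup>2) * P1 t / Q)\<bar> \<le> 32 * M * C1 * d"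
    proof -
      have "W1 (P t) / \<phi> t * (4 * l\<^sup>2 * (1 - t\<^sup>2) * P1 t / Q)
        = W1 (P t) * ((1 - t\<^sup>2) / \<phi> t) * P1 t * (4 * (l\<^sup>2 / Q))" by simp
      also have "\<bar>\<dots>\<bar> \<le> M * 8 * C1 * (4 * d)"
        unfolding abs_mult
      proof (intro mult_mono)
        have "1 - t\<^sup>2 = (1 - t) * (1 + t)" by (simp add: algebra_simps power2_eq_square)
        also have "\<dots> \<le> (1 - t) * 2" using t by (intro mult_left_mono) auto
        finally have "1 - t\<^sup>2 \<le> 8 * \<phi> t" using phi by linarith
        moreover have "t\<^sup>2 \<le> 1" using t by (simp add: power_le_one)
        ultimately show "\<bar>(1 - t\<^sup>2) / \<phi> t\<bar> \<le> 8" using phi(1) by (simp add: abs_divide pos_divide_le_eq)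
        show "\<bar>l\<^sup>2 / Q\<bar> \<le> d" using lQ Q l2 by simp
      qed (use C1(1) d0 M W1 P1 in auto)
      finally show ?thesis by simp
    qed
    have e4: "\<bar>4 * t * (P1 t)\<^sup>2 * K (P t) - K (sqrt t)\<bar> \<le> 63 * M * (A / \<sigma> t)"
    proof -
      \<comment> \<open>\<open>x\<close> is \<open>\<rho>'\<close>. The constant 63 is
        \<open>9 * 6\<close> for the squared slope plus 9 for the changed argument of
        \<open>K\<close>.\<close>
      define x where "x = 2 * sqrt t * P1 t"
      have x: "\<bar>x - 1\<bar> \<le> 9 * (A / \<sigma> t)" "0 \<le> x" "x \<le> 5"
        using near_sqrt(1,3)[of t] t P1(1) by (auto simp: x_def)
      have "4 * t * (P1 t)\<^sup>2 = x * x" using t by (simp add: x_def power2_eq_square)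
      then have "4 * t * (P1 t)\<^sup>2 * K (P t) - K (sqrt t) = (x - 1) * ((x + 1) * K (P t)) + (K (P t) - K (sqrt t))"
        by (simp add: algebra_simps)
      moreover have "\<bar>(x - 1) * ((x + 1) * K (P t))\<bar> \<le> (9 * (A / \<sigma> t)) * (6 * M)"
        unfolding abs_mult using x bound(1)[OF r(1)] As M by (intro mult_mono) auto
      moreover have "\<bar>K (P t) - K (sqrt t)\<bar> \<le> M * (9 * (A / \<sigma> t))"
        using lip(1)[OF r] mult_left_mono[OF near_sqrt(2)[of t] M] t by auto
      ultimately have "\<bar>4 * t * (P1 t)\<^sup>2 * K (P t) - K (sqrt t)\<bar>
          \<le> (9 * (A / \<sigma> t)) * (6 * M) + M * (9 * (A / \<sigma> t))"
        by linarith
      also have "\<dots> = 63 * M * (A / \<sigma> t)" by (simp add: algebra_simps)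
      finally show ?thesis .
    qed
    have e5: "\<bar>W1 (P t) / \<phi> t * (4 * t * P2 t + 2 * P1 t)\<bar> \<le> 10 * M * (A / \<sigma> t)"
    proof -
      have "\<bar>4 * t * P2 t + 2 * P1 t\<bar> \<le> 5/2 * (A / \<sigma> t) * (1 - t)"
        using flat_bounds[of t] t by (simp add: mult_ac)
      also have "\<dots> \<le> 5/2 * (A / \<sigma> t) * (4 * \<phi> t)"
        using phi As by (intro mult_left_mono) auto
      finally have "\<bar>(4 * t * P2 t + 2 * P1 t) / \<phi> t\<bar> \<le> 10 * (A / \<sigma> t)"
        unfolding abs_divide using phi(1) by (simp add: pos_divide_le_eq mult_ac)
      then have "\<bar>W1 (P t)\<bar> * \<bar>(4 * t * P2 t + 2 * P1 t) / \<phi> t\<bar> \<le> M * (10 * (A / \<sigma> t))"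
        using W1 M by (intro mult_mono) auto
      then show ?thesis by (simp add: abs_mult abs_divide mult_ac)
    qed
    have d: "d \<le> l / sqrt (t + l\<^sup>2)"
    proof -
      have "l \<le> sqrt (t + l\<^sup>2)" using t by (intro real_le_rsqrt) auto
      then have "(l / sqrt (t + l\<^sup>2))\<^sup>2 \<le> l / sqrt (t + l\<^sup>2)"
        using l tl power_decreasing[of 1 2 "l / sqrt (t + l\<^sup>2)"] by (simp add: divide_le_eq_1)
      moreover have "(l / sqrt (t + l\<^sup>2))\<^sup>2 = d" using tl by (simp add: d_def power_divide)
      ultimately show ?thesis by simp
    qed
    have tri: "\<bar>a + b + x + y + z\<bar> \<le> a' + b' + x' + y' + z'"
      if "\<bar>a\<bar> \<le> a'" "\<bar>b\<bar> \<le> b'" "\<bar>x\<bar> \<le> x'" "\<bar>y\<bar> \<le> y'" "\<bar>z\<bar> \<le> z'" for a b x y z a' b' x' y' z' :: real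
      using that[THEN abs_le_D1] that[THEN abs_le_D2] by (intro abs_leI) linarith+
    have "k l t - K (sqrt t) = (- l\<^sup>2 * t\<^sup>2 - 10 * l ^ 4 * t + 2 * l ^ 4 * t ^ 3) / Q\<^sup>2
      + 3 * l\<^sup>2 / \<phi> 0 ^ 4 * (\<phi> t ^ 4 - \<phi> 0 ^ 4) / Q\<^sup>2
      + (4 * t * (P1 t)\<^sup>2 * K (P t) - K (sqrt t))
      + W1 (P t) / \<phi> t * (4 * t * P2 t + 2 * P1 t)
      + W1 (P t) / \<phi> t * (4 * l\<^sup>2 * (1 - t\<^sup>2) * P1 t / Q)"
      unfolding k_def Q_def[symmetric] distrib_left by linarith
    then have "\<bar>k l t - K (sqrt t)\<bar> \<le> 12 * d + 3 * C2 * d + 63 * M * (A / \<sigma> t) + 10 * M * (A / \<sigma> t) + 32 * M * C1 * d"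
      by (simp only:) (rule tri[OF e1 e2 e4 e5 e3])
    also have "12 * d + 3 * C2 * d + 63 * M * (A / \<sigma> t) + 10 * M * (A / \<sigma> t) + 32 * M * C1 * d
        = 73 * M * (A / \<sigma> t) + (12 + 3 * C2 + 32 * M * C1) * d"
      by algebra
    also have "\<dots> \<le> 73 * M * (A / \<sigma> t) + (12 + 3 * C2 + 32 * M * C1) * (l / sqrt (t + l\<^sup>2))"
      by (rule add_left_mono[OF mult_left_mono[OF d]]) (use C1(1) C2(1) M in simp)
    finally show "\<bar>k l t - K (sqrt t)\<bar> \<le> 73 * M * A / \<sigma> t + (12 + 3 * C2 + 32 * M * C1) * l / sqrt (t + l\<^sup>2)"
      unfolding times_divide_eq_right .
  qed
qed

end

subsection \<open>Estimates for radial functions\<close>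

text \<open>\<open>K\<close> is \<open>h\<close> along a coordinate axis, so its derivative is a
  partial derivative of \<open>h\<close>, bounded because it extends continuously to the closed
  ball. Negative radii are kept to make 0 an interior point for the differential equation.\<close>

lemma radial_profile:
  fixes h :: "real ^ 'n::finite \<Rightarrow> real"
  assumes h: "C1_closure_on (ball 0 1) h" and rad: "radial_on (closure (ball 0 1)) h"
    and nonneg: "\<forall>x\<in>closure (ball 0 1). 0 \<le> h x"
  obtains K M where "\<And>x. x \<in> ball 0 1 \<Longrightarrow> h x = K (norm x)" "continuous_on {-1..1} K"
    "\<And>r. r \<in> {-1..1} \<Longrightarrow> 0 \<le> K r"
    "\<And>r s. r \<in> {-1..1} \<Longrightarrow> s \<in> {-1..1} \<Longrightarrow> \<bar>K r - K s\<bar> \<le> M * \<bar>r - s\<bar>"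
proof -
  fix i :: 'n
  define e :: "real ^ 'n" where "e = axis i 1"
  have e: "norm e = 1" by (simp add: e_def norm_axis_1)
  define K where "K r = h (r *\<^sub>R e)" for r
  have cl: "closure (ball 0 1) = (cball 0 1 :: (real ^ 'n) set)" by simp
  have cb: "r *\<^sub>R e \<in> cball 0 1" if "r \<in> {-1..1}" for r using that e by auto
  have contK: "continuous_on {-1..1} K"
    unfolding K_def
    by (rule continuous_on_compose2[where t = "cball 0 1" and g = h])
      (use h cb in \<open>auto simp: C1_closure_on_def intro!: continuous_intros\<close>)
  obtain g where g: "continuous_on (cball 0 1) g" "\<forall>x\<in>ball 0 1. g x = partial_deriv i h x"
    using h unfolding C1_closure_on_def cl by blast
  obtain x0 where x0: "\<forall>x\<in>cball 0 1. \<bar>g x\<bar> \<le> \<bar>g x0\<bar>"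
    using continuous_attains_sup[OF compact_cball _ continuous_on_rabs[OF g(1)]]
    by (auto simp del: mem_cball)
  have dK: "(K has_real_derivative g (r *\<^sub>R e)) (at r)" if "r \<in> {-1<..<1}" for r
  proof -
    have b: "r *\<^sub>R e \<in> ball 0 1" using that e by auto
    then have "h differentiable (at (r *\<^sub>R e))"
      using h unfolding C1_closure_on_def C1_on_def by blast
    then have dh: "(h has_derivative frechet_derivative h (at (r *\<^sub>R e))) (at (r *\<^sub>R e))"
      by (simp add: frechet_derivative_works)
    have "(K has_derivative (\<lambda>x. frechet_derivative h (at (r *\<^sub>R e)) (x *\<^sub>R e))) (at r)"
      unfolding K_def[abs_def] by (rule has_derivative_compose[where f = "\<lambda>r. r *\<^sub>R e" and x = r, OF _ dh]) (auto intro!: derivative_eq_intros)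
    moreover have "frechet_derivative h (at (r *\<^sub>R e)) (x *\<^sub>R e) = x * g (r *\<^sub>R e)" for x
      using linear_scale[OF has_derivative_linear[OF dh]] g(2) b
      by (simp add: partial_deriv_def e_def)
    ultimately show ?thesis by (simp add: has_field_derivative_def mult_commute_abs)
  qed
  have lip: "\<bar>K s - K r\<bar> \<le> \<bar>g x0\<bar> * \<bar>s - r\<bar>" if "r \<in> {-1..1}" "s \<in> {-1..1}" "r < s" for r s
  proof -
    have "\<exists>d z. r < z \<and> z < s \<and> DERIV K z :> d \<and> K s - K r = (s - r) * d"
    proof (rule MVT[OF that(3)])
      show "continuous_on {r..s} K" by (rule continuous_on_subset[OF contK]) (use that in auto)
      show "K differentiable (at x)" if "r < x" "x < s" for x
        using dK[of x] that \<open>r \<in> _\<close> \<open>s \<in> _\<close> by (auto simp: real_differentiable_def)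
    qed
    then obtain d z where z: "r < z" "z < s" "DERIV K z :> d" "K s - K r = (s - r) * d" by blast
    then have "d = g (z *\<^sub>R e)" using dK[of z] that DERIV_unique by fastforce
    then have "\<bar>d\<bar> \<le> \<bar>g x0\<bar>" using bspec[OF x0 cb[of z]] z that by simp
    then show ?thesis using that by (simp add: z(4) abs_mult mult.commute mult_left_mono)
  qed
  show ?thesis
  proof (rule that[OF _ contK])
    show "h x = K (norm x)" if "x \<in> ball 0 1" for x
      using rad that e unfolding radial_on_def K_def cl by auto
    show "0 \<le> K r" if "r \<in> {-1..1}" for r
      using nonneg cb[OF that] unfolding K_def cl by blast
    show "\<bar>K r - K s\<bar> \<le> \<bar>g x0\<bar> * \<bar>r - s\<bar>" if "r \<in> {-1..1}" "s \<in> {-1..1}" for r s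
      using lip[OF that] lip[OF that(2,1)] by (cases r s rule: linorder_cases) (auto simp: abs_minus_commute)
  qed
qed

lemma bounded_on_Icc:
  fixes f :: "real \<Rightarrow> real"
  assumes "continuous_on {a..b} f"
  obtains B where "0 \<le> B" "\<And>x. x \<in> {a..b} \<Longrightarrow> \<bar>f x\<bar> \<le> B"
proof (cases "a \<le> b")
  case True
  then obtain x where "\<forall>y\<in>{a..b}. \<bar>f y\<bar> \<le> \<bar>f x\<bar>"
    using continuous_attains_sup[of "{a..b}" "\<lambda>x. \<bar>f x\<bar>"] continuous_on_rabs[OF assms] by auto
  then show ?thesis by (intro that[of "\<bar>f x\<bar>"]) auto
qed (auto intro: that[of 0])

text \<open>On a set of diameter at most 2 a Lipschitz function is Hoelder continuous; the exponent
  \<open>1/2\<close> turns the power into a square root.\<close>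

lemma bounded_hoelder_radial:
  assumes "bdd_lipschitz k"
  shows "bounded_hoelder_on (1/2) (ball (0 :: real ^ 'n::finite) 1) (\<lambda>x. k (x \<bullet> x))"
proof -
  obtain C where C: "0 < C" "\<And>x. x \<in> {0..<1} \<Longrightarrow> \<bar>k x\<bar> \<le> C"
    "\<And>x y. x \<in> {0..<1} \<Longrightarrow> y \<in> {0..<1} \<Longrightarrow> \<bar>k x - k y\<bar> \<le> C * \<bar>x - y\<bar>"
    by (rule bdd_lipschitzE[OF assms]) blast
  have sq: "x \<bullet> x \<in> {0..<1}" if "x \<in> ball 0 1" for x :: "real ^ 'n"
    using that by (simp add: dot_square_norm power_less_one_iff)
  show ?thesis
    unfolding bounded_hoelder_on_def
  proof (intro conjI exI ballI)
    show "bounded ((\<lambda>x. k (x \<bullet> x)) ` ball (0 :: real ^ 'n) 1)"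
      unfolding bounded_iff using C(2) sq by (auto intro!: exI[of _ C])
    fix x y :: "real ^ 'n" assume xy: "x \<in> ball 0 1" "y \<in> ball 0 1"
    define d where "d = dist x y"
    have d: "0 \<le> d" "d \<le> 2" using xy norm_triangle_ineq4[of x y] by (auto simp: d_def dist_norm)
    have "x \<bullet> x - y \<bullet> y = (x - y) \<bullet> (x + y)" by (simp add: algebra_simps inner_commute)
    then have "\<bar>x \<bullet> x - y \<bullet> y\<bar> \<le> norm (x - y) * norm (x + y)"
      using Cauchy_Schwarz_ineq2[of "x - y" "x + y"] by simp
    also have "\<dots> \<le> d * 2"
      using xy norm_triangle_ineq[of x y] by (intro mult_mono) (auto simp: d_def dist_norm)
    also have "d = sqrt d * sqrt d" using d by simp
    also have "\<dots> \<le> 2 * sqrt d" using d by (intro mult_right_mono real_le_lsqrt) auto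
    finally have "\<bar>x \<bullet> x - y \<bullet> y\<bar> \<le> 4 * sqrt d" by simp
    then have "C * \<bar>x \<bullet> x - y \<bullet> y\<bar> \<le> C * (4 * sqrt d)" using C by (intro mult_left_mono) auto
    then show "\<bar>k (x \<bullet> x) - k (y \<bullet> y)\<bar> \<le> (4 * C) * dist x y powr (1/2)"
      using C(3)[OF sq[OF xy(1)] sq[OF xy(2)]] d by (simp add: powr_half_sqrt flip: d_def)
  qed
qed

text \<open>Convexity separates the cubes of the two terms, and \<open>dyadic\<close> bounds each;
  the factors \<open>real N + 1\<close> and \<open>real m + 1\<close> are the logarithmic growth of
  the integrals.\<close>

lemma L3_bound:
  fixes F :: "real ^ 3 \<Rightarrow> real"
  assumes e: "0 \<le> a" "0 \<le> b" and \<epsilon>: "0 < \<epsilon>"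
    and bound: "\<And>x. x \<in> ball 0 1 \<Longrightarrow>
      \<bar>F x\<bar> \<le> a / sqrt (x \<bullet> x + ((1/2)^N)\<^sup>2) + b / sqrt (x \<bullet> x + ((1/2)^m)\<^sup>2)"
    and small: "4 * a ^ 3 * (32 / 3 * pi * (real N + 1)) \<le> \<epsilon> ^ 3 / 2"
      "4 * b ^ 3 * (32 / 3 * pi * (real m + 1)) \<le> \<epsilon> ^ 3 / 2"
  shows "Lp_norm_on 3 (ball 0 1) F \<le> \<epsilon>"
proof -
  have cube: "(x + y) ^ 3 \<le> 4 * x ^ 3 + 4 * y ^ 3" if "0 \<le> x" "0 \<le> y" for x y :: real
  proof -
    have "4 * x ^ 3 + 4 * y ^ 3 - (x + y) ^ 3 = 3 * ((x + y) * (x - y)\<^sup>2)"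
      by (simp add: algebra_simps power2_eq_square power3_eq_cube)
    moreover have "0 \<le> (x + y) * (x - y)\<^sup>2" using that by auto
    ultimately show ?thesis by linarith
  qed
  let ?D = "\<lambda>x. 4 * a ^ 3 * dyadic N x + 4 * b ^ 3 * dyadic m x"
  have "(LINT x:ball 0 1|lebesgue. \<bar>F x\<bar> powr 3) \<le> (LINT x|lebesgue. ?D x)"
    unfolding set_lebesgue_integral_def
  \<comment> \<open>A non-integrable left side would have integral 0, so integrability and
    nonnegativity of the majorant \<open>?D\<close> suffice.\<close>
  proof (rule Bochner_Integration.integral_mono')
    show "integrable lebesgue ?D"
      by (intro Bochner_Integration.integrable_add integrable_mult_right dyadic_integral)
    fix x :: "real ^ 3"
    show D: "0 \<le> ?D x" using e dyadic_nonneg by auto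
    show "indicat_real (ball 0 1) x *\<^sub>R \<bar>F x\<bar> powr 3 \<le> ?D x"
    proof (cases "x \<in> ball 0 1")
      case True
      let ?s = "1 / sqrt (x \<bullet> x + ((1/2)^N)\<^sup>2)" and ?t = "1 / sqrt (x \<bullet> x + ((1/2)^m)\<^sup>2)"
      have "\<bar>F x\<bar> ^ 3 \<le> (a * ?s + b * ?t) ^ 3"
        using bound[OF True] by (intro power_mono) auto
      also have "\<dots> \<le> 4 * (a * ?s) ^ 3 + 4 * (b * ?t) ^ 3"
        using e by (intro cube) auto
      also have "\<dots> = 4 * a ^ 3 * ?s ^ 3 + 4 * b ^ 3 * ?t ^ 3"
        by (simp only: power_mult_distrib mult.assoc)
      also have "\<dots> \<le> ?D x"
        using e by (intro add_mono mult_left_mono inverse_cube_le_dyadic True) auto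
      finally have "\<bar>F x\<bar> ^ 3 \<le> ?D x" .
      then show ?thesis using True by simp
    qed (use D in auto)
  qed
  also have "\<dots> = 4 * a ^ 3 * (32 / 3 * pi * (real N + 1)) + 4 * b ^ 3 * (32 / 3 * pi * (real m + 1))"
    by (subst Bochner_Integration.integral_add)
      (auto intro!: integrable_mult_right dyadic_integral simp: dyadic_integral)
  also have "\<dots> \<le> \<epsilon> ^ 3" using small by simp
  finally have I: "(LINT x:ball 0 1|lebesgue. \<bar>F x\<bar> powr 3) \<le> \<epsilon> ^ 3" .
  have "0 \<le> (LINT x:ball 0 1|lebesgue. \<bar>F x\<bar> powr 3)"
    unfolding set_lebesgue_integral_def by (rule Bochner_Integration.integral_nonneg) auto
  then have "Lp_norm_on 3 (ball 0 1) F \<le> (\<epsilon> ^ 3) powr (1 / 3)"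
    unfolding Lp_norm_on_def using I by (intro powr_mono2) auto
  also have "\<dots> = \<epsilon>" using \<epsilon> by (simp add: powr_powr flip: powr_numeral)
  finally show ?thesis .
qed

text \<open>For \<open>\<mu> = (1/2)^N\<close>, \<open>A\<close> is of order \<open>1 / N\<close>,
  and its cube beats the growth \<open>N + 1\<close> of the integral. \<open>3 \<le> N\<close>
  ensures \<open>\<mu> \<le> 1/8\<close>.\<close>

lemma cube_decay:
  fixes c e :: real
  assumes "0 \<le> c" "0 < e"
  obtains N where "3 \<le> N" "(c / real N) ^ 3 * (real N + 1) \<le> e"
proof -
  obtain N0 :: nat where N0: "2 * c ^ 3 / e \<le> real N0" using real_arch_simple by blast
  define N where "N = max 3 N0"
  have N: "3 \<le> N" "2 * c ^ 3 / e \<le> real N" using N0 by (auto simp: N_def)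
  have "(c / real N) ^ 3 * (real N + 1) \<le> (c / real N) ^ 3 * (real N * real N)"
  proof (rule mult_left_mono)
    have "3 * real N \<le> real N * real N" using N(1) by (intro mult_right_mono) auto
    then show "real N + 1 \<le> real N * real N" using N(1) by linarith
  qed (use assms in auto)
  also have "\<dots> = c ^ 3 / real N" using N(1) by (simp add: power_divide power3_eq_cube)
  also have "\<dots> \<le> e" using N assms by (simp add: field_simps) (smt (verit) zero_le_power)
  finally show ?thesis using N(1) that by blast
qed

text \<open>The counterpart for the bubble width \<open>l = (1/2)^m\<close>.\<close>

lemma geometric_decay:
  fixes c e :: real
  assumes "0 \<le> c" "0 < e"
  obtains m where "(c * (1/2)^m) ^ 3 * (real m + 1) \<le> e"
proof -
  have "0 < c ^ 3 + 1" using assms by (intro add_nonneg_pos) auto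
  then have "0 < e / (c ^ 3 + 1)" using assms by simp
  then obtain m where m: "(1/2 :: real) ^ m < e / (c ^ 3 + 1)"
    using real_arch_pow_inv[of "e / (c ^ 3 + 1)" "1/2"] by auto
  have "real m + 1 \<le> 2 ^ m"
    using less_exp[of m] by (metis Suc_leI of_nat_Suc of_nat_le_iff of_nat_numeral of_nat_power add.commute)
  then have "(c * (1/2)^m) ^ 3 * (real m + 1) \<le> (c * (1/2)^m) ^ 3 * 2 ^ m"
    using assms by (intro mult_left_mono) auto
  also have "\<dots> = c ^ 3 * ((1/2)^m * (1/2)^m)"
    by (simp add: power_mult_distrib power3_eq_cube power_one_over field_simps)
  also have "\<dots> \<le> c ^ 3 * (1 * (1/2)^m)"
    using assms by (intro mult_left_mono mult_right_mono) (auto simp: power_le_one)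
  also have "\<dots> \<le> c ^ 3 * (e / (c ^ 3 + 1))"
    using assms m by (intro mult_left_mono) auto
  also have "\<dots> \<le> e"
    using assms \<open>0 < c ^ 3 + 1\<close> by (simp add: pos_divide_le_eq algebra_simps)
  finally show ?thesis using that by blast
qed

section \<open>Existence of the profile and assembly of the solution\<close>

text \<open>The equation is solved from the boundary inwards in \<open>s = 1 - r\<close>, so
  \<open>y 0 = 0\<close> becomes \<open>W 1 = 0\<close> and \<open>s \<le> y s\<close> becomes
  \<open>1 - r \<le> W r\<close>. The interval of length 2 carries the solution past the
  centre.\<close>

lemma bubble_profile_exists:
  assumes cont: "continuous_on {-1..1} K" and nonneg: "\<And>r. r \<in> {-1..1} \<Longrightarrow> 0 \<le> K r"
    and lip: "\<And>r s. r \<in> {-1..1} \<Longrightarrow> s \<in> {-1..1} \<Longrightarrow> \<bar>K r - K s\<bar> \<le> M0 * \<bar>r - s\<bar>"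
  shows "\<exists>W W1 M. \<forall>\<mu>. 0 < \<mu> \<longrightarrow> \<mu> \<le> 1/8 \<longrightarrow> bubble_profile \<mu> K W W1 M"
proof -
  have k: "continuous_on {0..2} (\<lambda>s. K (1 - s))"
    by (rule continuous_on_compose2[OF cont]) (auto intro!: continuous_intros)
  obtain y z where y0: "y 0 = 0"
    and dy: "\<And>s. s \<in> {0..2} \<Longrightarrow> (y has_real_derivative z s) (at s within {0..2})"
    and dz: "\<And>s. s \<in> {0..2} \<Longrightarrow> (z has_real_derivative K (1 - s) * y s) (at s within {0..2})"
    and y_ge: "\<And>s. s \<in> {0..2} \<Longrightarrow> s \<le> y s"
    by (rule linear_second_order_ode[OF _ k]) (use nonneg in auto)
  have cy: "continuous_on {0..2} y" and cz: "continuous_on {0..2} z"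
    by (rule DERIV_continuous_on, erule dy) (rule DERIV_continuous_on, erule dz)
  obtain B1 where B1: "0 \<le> B1" "\<And>s. s \<in> {0..2} \<Longrightarrow> \<bar>K (1 - s)\<bar> \<le> B1" by (rule bounded_on_Icc[OF k]) blast
  obtain B2 where B2: "0 \<le> B2" "\<And>s. s \<in> {0..2} \<Longrightarrow> \<bar>z s\<bar> \<le> B2" by (rule bounded_on_Icc[OF cz]) blast
  obtain B3 where B3: "0 \<le> B3" "\<And>s. s \<in> {0..2} \<Longrightarrow> \<bar>K (1 - s) * y s\<bar> \<le> B3"
    by (rule bounded_on_Icc[OF continuous_on_mult[OF k cy]]) blast
  define M where "M = \<bar>M0\<bar> + B1 + B2 + B3"
  have M: "M0 \<le> M" "B1 \<le> M" "B2 \<le> M" "B3 \<le> M" using B1(1) B2(1) B3(1) by (auto simp: M_def)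
  have ly: "\<bar>y s - y t\<bar> \<le> M * \<bar>s - t\<bar>" if "s \<in> {0..2}" "t \<in> {0..2}" for s t
  proof -
    have "norm (y s - y t) \<le> M * norm (s - t)"
      by (rule field_differentiable_bound[OF _ dy]) (use that in \<open>auto intro: order_trans[OF B2(2) M(3)]\<close>)
    then show ?thesis by simp
  qed
  have lz: "\<bar>z s - z t\<bar> \<le> M * \<bar>s - t\<bar>" if "s \<in> {0..2}" "t \<in> {0..2}" for s t
  proof -
    have "norm (z s - z t) \<le> M * norm (s - t)"
      by (rule field_differentiable_bound[OF _ dz]) (use that in \<open>auto intro: order_trans[OF B3(2) M(4)]\<close>)
    then show ?thesis by simp
  qed
  have interior: "(F has_real_derivative D) (at s)"
    if "(F has_real_derivative D) (at s within {0..2})" "s \<in> {0<..<2}" for F D and s :: real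
    using that by (simp add: at_within_Icc_at)
  show ?thesis
  proof (intro exI allI impI)
    fix \<mu> :: real assume "0 < \<mu>" "\<mu> \<le> 1/8"
    show "bubble_profile \<mu> K (\<lambda>r. y (1 - r)) (\<lambda>r. - z (1 - r)) M"
    proof unfold_locales
      fix r :: real
      { assume r: "r \<in> {-1<..<1}"
        then have s: "1 - r \<in> {0<..<2}" "1 - r \<in> {0..2}" by auto
        have s': "((\<lambda>r. 1 - r) has_real_derivative - 1) (at r)" by (auto intro!: derivative_eq_intros)
        show "((\<lambda>r. y (1 - r)) has_real_derivative - z (1 - r)) (at r)"
          using DERIV_chain2[OF interior[OF dy[OF s(2)] s(1)] s'] by simp
        show "((\<lambda>r. - z (1 - r)) has_real_derivative K r * y (1 - r)) (at r)"
          using DERIV_minus[OF DERIV_chain2[OF interior[OF dz[OF s(2)] s(1)] s']] by simp }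
      { assume r: "r \<in> {0..1}"
        then have s: "1 - r \<in> {0..2}" by auto
        show "1 - r \<le> y (1 - r)" by (rule y_ge[OF s])
        show "\<bar>K r\<bar> \<le> M" using B1(2)[OF s] M by simp
        show "\<bar>- z (1 - r)\<bar> \<le> M" using B2(2)[OF s] M by simp
        fix t :: real assume t: "t \<in> {0..1}"
        then have s': "1 - t \<in> {0..2}" by auto
        have "M0 * \<bar>r - t\<bar> \<le> M * \<bar>r - t\<bar>" using M by (intro mult_right_mono) auto
        then show "\<bar>K r - K t\<bar> \<le> M * \<bar>r - t\<bar>" using lip[of r t] r t by auto
        show "\<bar>y (1 - r) - y (1 - t)\<bar> \<le> M * \<bar>r - t\<bar>"
          using ly[OF s s'] by (simp add: abs_minus_commute)
        show "\<bar>- z (1 - r) - - z (1 - t)\<bar> \<le> M * \<bar>r - t\<bar>"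
          using lz[OF s s'] by (simp add: abs_minus_commute) }
    next
      show "continuous_on {0..1} (\<lambda>r. y (1 - r))"
        by (rule continuous_on_compose2[OF cy]) (auto intro!: continuous_intros)
    qed (use y0 \<open>0 < \<mu>\<close> \<open>\<mu> \<le> 1/8\<close> in auto)
  qed
qed

lemma (in bubble_profile) critical_solution:
  assumes l: "0 < l" "l \<le> 1"
  shows "critical_dirichlet_solution (ball 0 1) (\<lambda>x. k l (x \<bullet> x)) (\<lambda>x. f l (x \<bullet> x))"
    "\<forall>x\<in>ball (0 :: real ^ 3) 1. 0 < f l (x \<bullet> x)"
proof -
  have sq: "x \<bullet> x \<in> {0..<1}" if "x \<in> ball 0 1" for x :: "real ^ 3"
    using that by (simp add: dot_square_norm power_less_one_iff)
  have cont: "continuous_on (ball (0 :: real ^ 3) 1) (\<lambda>x. f2 l (x \<bullet> x))"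
    by (rule continuous_on_compose2[OF f2_continuous[OF l]]) (use sq in \<open>auto intro!: continuous_intros\<close>)
  note C2 = radial_C2_on[OF open_ball f_has_derivative(1)[OF l sq] f_has_derivative(2)[OF l sq] cont]
  show "critical_dirichlet_solution (ball 0 1) (\<lambda>x. k l (x \<bullet> x)) (\<lambda>x. f l (x \<bullet> x))"
    unfolding critical_dirichlet_solution_def
  proof (intro conjI ballI)
    show "C2_on (ball (0 :: real ^ 3) 1) (\<lambda>x. f l (x \<bullet> x))" by (rule C2(1))
    show "continuous_on (closure (ball (0 :: real ^ 3) 1)) (\<lambda>x. f l (x \<bullet> x))"
      by (rule continuous_on_compose2[OF f_continuous[OF l]])
        (auto intro!: continuous_intros simp: dot_square_norm power_le_one_iff)
    show "laplacian (\<lambda>x. f l (x \<bullet> x)) x + k l (x \<bullet> x) * f l (x \<bullet> x) = f l (x \<bullet> x) ^ 5"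
      if "x \<in> ball 0 1" for x :: "real ^ 3"
      using f_equation[OF l sq[OF that]] C2(2)[of x] that by simp
    show "f l (x \<bullet> x) = 0" if "x \<in> frontier (ball 0 1)" for x :: "real ^ 3"
      using that f_1[OF l] by (simp add: dot_square_norm)
  qed
  show "\<forall>x\<in>ball (0 :: real ^ 3) 1. 0 < f l (x \<bullet> x)" using f_pos[OF l sq] by blast
qed

theorem theorem4:
  fixes B :: "(real ^ 3) set" and h :: "real ^ 3 \<Rightarrow> real" and \<epsilon> :: real
  defines "B \<equiv> ball 0 1"
  assumes "C1_closure_on B h"
    and "\<forall>x\<in>closure B. 0 \<le> h x"
    and "radial_on (closure B) h"
    and "0 < \<epsilon>"
  shows "\<exists>\<eta> h' u. 0 < \<eta> \<and> \<eta> < 1 \<and>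
           bounded_hoelder_on \<eta> B h' \<and> radial_on B h' \<and>
           Lp_norm_on 3 B (\<lambda>x. h' x - h x) \<le> \<epsilon> \<and>
           critical_dirichlet_solution B h' u \<and>
           (\<forall>x\<in>B. 0 < u x) \<and> radial_on (closure B) u"
proof -
  obtain K M0 where K: "\<And>x. x \<in> ball 0 1 \<Longrightarrow> h x = K (norm x)" "continuous_on {-1..1} K"
    "\<And>r. r \<in> {-1..1} \<Longrightarrow> 0 \<le> K r"
    "\<And>r s. r \<in> {-1..1} \<Longrightarrow> s \<in> {-1..1} \<Longrightarrow> \<bar>K r - K s\<bar> \<le> M0 * \<bar>r - s\<bar>"
    by (rule radial_profile[OF assms(2,4,3)[unfolded B_def]]) blast
  obtain W W1 M where W: "\<And>\<mu>. 0 < \<mu> \<Longrightarrow> \<mu> \<le> 1/8 \<Longrightarrow> bubble_profile \<mu> K W W1 M"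
    using bubble_profile_exists[OF K(2-4)] by blast
  have M: "0 \<le> M" using bubble_profile.bound(1)[OF W, of "1/8" 0] by simp
  \<comment> \<open>\<open>219 = 73 * 3\<close>: 73 is the constant of \<open>k_estimate\<close>,
    and \<open>A \<le> 3 / real N\<close> is derived below.\<close>
  define b where "b = 219 * M"
  \<comment> \<open>Each of the two errors gets half of \<open>\<epsilon> ^ 3\<close>;
    \<open>256 / 3 * pi\<close> is \<open>2 * 4 * (32 / 3 * pi)\<close>, with the 4 from the cube of
    a sum.\<close>
  have \<epsilon>': "0 < \<epsilon> ^ 3 / (256 / 3 * pi)" using assms(5) by simp
  obtain N where N: "3 \<le> N" "(b / real N) ^ 3 * (real N + 1) \<le> \<epsilon> ^ 3 / (256 / 3 * pi)"
    by (rule cube_decay[OF _ \<epsilon>', of b]) (use M in \<open>auto simp: b_def\<close>)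
  define \<mu> where "\<mu> = (1/2 :: real) ^ N"
  have mu: "0 < \<mu>" "\<mu> \<le> 1/8"
    using power_decreasing[OF N(1), of "1/2 :: real"] by (auto simp: \<mu>_def power3_eq_cube)
  interpret bubble_profile \<mu> K W W1 M by (rule W[OF mu])
  have L: "L = real N * ln 2" unfolding L_def by (simp add: \<mu>_def power_one_over ln_realpow)
  \<comment> \<open>As \<open>3 \<le> N\<close>, subtracting 1 from \<open>2/3 * real N\<close>
    leaves at least \<open>real N / 3\<close>.\<close>
  have "2/3 * real N \<le> L" unfolding L
    using mult_left_mono[OF ln2_ge_two_thirds, of "real N"] by simp
  then have "real N / 3 \<le> L - 1" using N(1) by simp
  then have "A * (real N / 3) \<le> A * (L - 1)" using A_bounds(1) by (intro mult_left_mono) auto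
  with A_bounds(3) have "A * (real N / 3) \<le> 1" by linarith
  then have "A \<le> 3 / real N" using N(1) by (simp add: pos_le_divide_eq)
  then have "73 * M * A \<le> 73 * M * (3 / real N)" using M by (intro mult_left_mono) auto
  then have Aa: "73 * M * A \<le> b / real N" by (simp add: b_def)
  \<comment> \<open>\<open>C\<close> is available only now that \<open>\<mu>\<close> is fixed;
    \<open>m\<close>, and with it \<open>l\<close>, is chosen last.\<close>
  obtain C where C: "0 \<le> C" "\<And>l t. 0 < l \<Longrightarrow> l \<le> 1 \<Longrightarrow> t \<in> {0..<1} \<Longrightarrow>
      \<bar>k l t - K (sqrt t)\<bar> \<le> 73 * M * A / \<sigma> t + C * l / sqrt (t + l\<^sup>2)"
    by (rule k_estimate) blast
  obtain m where m: "(C * (1/2)^m) ^ 3 * (real m + 1) \<le> \<epsilon> ^ 3 / (256 / 3 * pi)"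
    by (rule geometric_decay[OF C(1) \<epsilon>'])
  have scale: "4 * x ^ 3 * (32 / 3 * pi * (real n + 1)) \<le> \<epsilon> ^ 3 / 2"
    if "x ^ 3 * (real n + 1) \<le> \<epsilon> ^ 3 / (256 / 3 * pi)" for x n
    using that by (simp add: field_simps)
  define l where "l = (1/2 :: real) ^ m"
  have l: "0 < l" "l \<le> 1" by (auto simp: l_def power_le_one)
  have "Lp_norm_on 3 (ball 0 1) (\<lambda>x. k l (x \<bullet> x) - h x) \<le> \<epsilon>"
  proof (rule L3_bound[OF _ _ assms(5) _ scale[OF N(2)] scale[OF m]])
    show "0 \<le> b / real N" using M by (simp add: b_def)
    show "0 \<le> C * (1/2)^m" using C by simp
    fix x :: "real ^ 3" assume x: "x \<in> ball 0 1"
    have "x \<bullet> x \<in> {0..<1}" using x by (simp add: dot_square_norm power_less_one_iff)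
    from C(2)[OF l this]
    have "\<bar>k l (x \<bullet> x) - h x\<bar> \<le> 73 * M * A / \<sigma> (x \<bullet> x) + C * l / sqrt (x \<bullet> x + l\<^sup>2)"
      by (simp add: K(1)[OF x] norm_eq_sqrt_inner)
    also have "\<dots> \<le> (b / real N) / \<sigma> (x \<bullet> x) + C * l / sqrt (x \<bullet> x + l\<^sup>2)"
      using Aa by (intro add_right_mono divide_right_mono) (auto simp: \<sigma>_def)
    finally show "\<bar>k l (x \<bullet> x) - h x\<bar> \<le> b / real N / sqrt (x \<bullet> x + ((1/2)^N)\<^sup>2) + C * (1/2)^m / sqrt (x \<bullet> x + ((1/2)^m)\<^sup>2)"
      unfolding \<sigma>_def by (simp only: \<mu>_def l_def)
  qed
  moreover have "radial_on S (\<lambda>x. F (x \<bullet> x))" for S :: "(real ^ 3) set" and F :: "real \<Rightarrow> real"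
    by (simp add: radial_on_def dot_square_norm)
  ultimately show ?thesis
    unfolding B_def
    using bounded_hoelder_radial[OF bdd_lipschitz_k[OF l]] critical_solution[OF l]
    by (intro exI[of _ "1/2"] exI[of _ "\<lambda>x. k l (x \<bullet> x)"] exI[of _ "\<lambda>x. f l (x \<bullet> x)"]) auto
qed

end
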